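(* There exists a contractible, non-metrizable Type I surface.
   Context: A manifold (of dimension $n\ge 1$) is a connected Hausdorff space each of whose points has a neighborhood homeomorphic to $\mathbb{R}^n$; a surface is a $2$-manifold. No second countability or metrizability is assumed. A space $X$ is of Type I if $X=\bigcup_{\alpha\in\omega_1}X_\alpha$, where each $X_\alpha$ is open, each closure $\overline{X_\alpha}$ is Lindelöf, and $\overline{X_\alpha}\subset X_\beta$ whenever $\alpha<\beta<\omega_1$. A space is contractible if its identity map is homotopic to a constant map. *)

theory Defs
  imports "HOL-Analysis.Analysis"
begin

text \<open>
  Connected Hausdorff spaces locally homeomorphic to \<open>\<real>\<^sup>n\<close>; no second countability is assumed.
  A neighbourhood \<open>N\<close> of \<open>x\<close> need not be open. \<open>Euclidean_space n\<close> is \<open>\<real>\<^sup>n\<close>,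
  realised as the real sequences vanishing from index \<open>n\<close> on.
\<close>

definition manifold :: "nat \<Rightarrow> 'a topology \<Rightarrow> bool" where
  "manifold n X \<longleftrightarrow>
     1 \<le> n \<and> connected_space X \<and> Hausdorff_space X \<and>
     (\<forall>x\<in>topspace X. \<exists>U N. openin X U \<and> x \<in> U \<and> U \<subseteq> N \<and> N \<subseteq> topspace X \<and>
        subtopology X N homeomorphic_space Euclidean_space n)"

abbreviation surface :: "'a topology \<Rightarrow> bool" where
  "surface \<equiv> manifold 2"

text \<open>
  The ordinal \<open>\<omega>\<^sub>1\<close>, represented as a well-order: the cardinal successor of \<open>\<omega>\<close>. The sets of
  naturals in its field are mere names for the countable ordinals, and \<open>\<alpha> < \<beta>\<close> is
  \<open>\<alpha> \<in> underS omega1 \<beta>\<close>. Being an uncountable well-order with countable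
  initial segments (see the lemmas below) determines it up to isomorphism.
\<close>

definition omega1 :: "nat set rel" where
  "omega1 = cardSuc natLeq"

lemma Well_order_omega1: "Well_order omega1"
  unfolding omega1_def
  using cardSuc_Card_order natLeq_Card_order card_order_on_well_order_on by blast

lemma countable_iff_ordLeq_natLeq: "countable A \<longleftrightarrow> (card_of A, natLeq) \<in> ordLeq"
proof -
  have "countable A \<longleftrightarrow> (card_of A, card_of (UNIV :: nat set)) \<in> ordLeq"
    unfolding countable_def using card_of_ordLeq[of A "UNIV :: nat set"] by simp
  then show ?thesis
    using card_of_nat ordLeq_ordIso_trans ordIso_symmetric by blast
qed

lemma uncountable_Field_omega1: "uncountable (Field omega1)"
proof
  have co: "Card_order (cardSuc natLeq)"
    using cardSuc_Card_order natLeq_Card_order by blast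
  assume "countable (Field omega1)"
  then have "(card_of (Field omega1), natLeq) \<in> ordLeq"
    by (simp add: countable_iff_ordLeq_natLeq)
  then have "(cardSuc natLeq, natLeq) \<in> ordLeq"
    unfolding omega1_def using card_of_Field_ordIso[OF co] ordIso_ordLeq_trans ordIso_symmetric
    by blast
  then show False
    using cardSuc_greater[OF natLeq_Card_order] not_ordLess_ordLeq by blast
qed

lemma countable_underS_omega1:
  assumes "\<beta> \<in> Field omega1"
  shows "countable (underS omega1 \<beta>)"
proof -
  have co: "Card_order (cardSuc natLeq)"
    using cardSuc_Card_order natLeq_Card_order by blast
  have "(card_of (underS omega1 \<beta>), cardSuc natLeq) \<in> ordLess"
    using card_of_underS[OF co] assms unfolding omega1_def by blast
  then have "(card_of (underS omega1 \<beta>), natLeq) \<in> ordLeq"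
    using cardSuc_ordLeq_ordLess[OF natLeq_Card_order card_of_Card_order] by blast
  then show ?thesis
    by (simp add: countable_iff_ordLeq_natLeq)
qed

definition type_I :: "'a topology \<Rightarrow> bool" where
  "type_I X \<longleftrightarrow>
     (\<exists>A :: nat set \<Rightarrow> 'a set.
        topspace X = (\<Union>\<alpha>\<in>Field omega1. A \<alpha>) \<and>
        (\<forall>\<alpha>\<in>Field omega1. openin X (A \<alpha>) \<and> Lindelof_space (subtopology X (X closure_of A \<alpha>))) \<and>
        (\<forall>\<beta>\<in>Field omega1. \<forall>\<alpha>\<in>underS omega1 \<beta>. X closure_of A \<alpha> \<subseteq> A \<beta>))"

end

theory Submission
  imports Defs
begin

text \<open>
  The surface is a line bundle over a branching one-dimensional space that is modelled on a special
  Aronszajn tree, twisted so strongly at the branch points that the total space is Hausdorff.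

  The tree. A node is a compact set \<open>s\<close> of nonnegative rationals containing \<open>0\<close> in which each
  \<open>a \<in> s\<close> is followed by a gap of length at least \<open>wait a > 0\<close>. Such a set is well-ordered, and its
  predecessors in the tree are its initial segments. Only finitely many rationals have \<open>wait\<close> above a
  given bound. A transfinite recursion (\<open>tree_levels_exist\<close>) selects countably many nodes on each
  level \<open>\<alpha> < \<omega>\<^sub>1\<close> so that no level is empty; at limit levels compactness of the sets says that a node
  contains its limits, so a node is determined by its predecessors.

  The surface. A node \<open>s\<close> contributes a half plane \<open>strip s\<close> of points \<open>(r, y)\<close> with \<open>y\<close> below
  \<open>ht s = Sup s + wait (Sup s)\<close>. Two nodes that share exactly the initial segment with maximum \<open>c\<close> share
  the part below height \<open>c + wait c\<close>. It is identified by the shift of \<open>r\<close> by a nonzero multiple of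
  \<open>bump c y\<close>, which vanishes for \<open>y \<le> c\<close> and tends to infinity as \<open>y\<close> tends to \<open>c + wait c\<close>. So a
  sequence that converges in one half plane to a point at that height leaves every compact part of the
  other one, which gives the Hausdorff property (\<open>Hausdorff_surf\<close>).

  Type I and nonmetrizability. The half planes of the nodes on levels below \<open>\<alpha>\<close> form an open set
  \<open>below \<alpha>\<close>. Its closure adds at most bottom fibres of nodes on level \<open>\<alpha>\<close>, so it lies in a countable
  union of planes (\<open>closure_below\<close>). If the surface were metrizable it would be separable, being
  connected and locally separable; a countable dense set lies in some \<open>below \<alpha>\<close>, whose closure
  is not everything.

  Contractibility. Near a height at which \<open>bump a\<close> is positive, let a point move down so that \<open>bump a\<close>
  and the fibre coordinate are multiplied by the same factor \<open>k\<close>. Since the charts differ by multiples of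
  \<open>bump a\<close>, this motion multiplies the fibre coordinate by \<open>k\<close> in all charts simultaneously. So it is well
  defined on the surface, although no section of the bundle exists. It is used twice. First
  (\<open>squeeze\<close>) the factor moves from \<open>1\<close> to a number that vanishes exactly where the bump does; afterwards
  the fibre coordinate is zero at every height where the bump vanishes. Then (\<open>collapse\<close>) everything slides
  down to height \<open>0\<close>: the fibre coordinate changes by the same factor as the bump of the starting stage, so
  it is zero once the point has left that stage, and below the stage all charts around the starting point
  agree. Continuity of the first homotopy at limit heights holds because a point in the stage of \<open>a\<close>
  moves down by at most \<open>wait a\<close>, its final factor is at most \<open>wait a\<close>, and these numbers tend to zero along a node.
\<close>

section \<open>The countable ordinals as a well-ordered type\<close>

text \<open>A type in class \<^class>\<open>wellorder\<close> makes the recursion over the levels of the tree readable.\<close>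

typedef countable_ordinal = "Field omega1"
proof -
  have "Field omega1 \<noteq> {}" using uncountable_Field_omega1 by auto
  then show "\<exists>x. x \<in> Field omega1" by blast
qed


instantiation countable_ordinal :: wellorder
begin

definition less_eq_countable_ordinal :: "countable_ordinal \<Rightarrow> countable_ordinal \<Rightarrow> bool" where
  "x \<le> y \<longleftrightarrow> (Rep_countable_ordinal x, Rep_countable_ordinal y) \<in> omega1"

definition less_countable_ordinal :: "countable_ordinal \<Rightarrow> countable_ordinal \<Rightarrow> bool" where
  "x < y \<longleftrightarrow> Rep_countable_ordinal x \<in> underS omega1 (Rep_countable_ordinal y)"

instance
proof
  interpret wo_rel omega1 using Well_order_omega1 by (simp add: wo_rel_def)
  fix x y z :: countable_ordinal
  show "x < y \<longleftrightarrow> x \<le> y \<and> \<not> y \<le> x"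
    using antisymD[OF ANTISYM] Rep_countable_ordinal_inject[of x y]
      REFL Rep_countable_ordinal[of x]
    unfolding less_eq_countable_ordinal_def less_countable_ordinal_def underS_def refl_on_def
    by (metis (mono_tags, lifting) mem_Collect_eq)
  show "x \<le> x"
    using REFL Rep_countable_ordinal[of x] by (simp add: less_eq_countable_ordinal_def refl_on_def)
  show "x \<le> z" if "x \<le> y" "y \<le> z"
    using that transD[OF TRANS] unfolding less_eq_countable_ordinal_def by blast
  show "x = y" if "x \<le> y" "y \<le> x"
    using that antisymD[OF ANTISYM] unfolding less_eq_countable_ordinal_def
    by (metis Rep_countable_ordinal_inject)
  show "x \<le> y \<or> y \<le> x"
    using TOTALS Rep_countable_ordinal[of x] Rep_countable_ordinal[of y]
    unfolding less_eq_countable_ordinal_def by blast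
  fix P :: "countable_ordinal \<Rightarrow> bool" and a :: countable_ordinal
  assume step: "\<And>x. (\<And>y. y < x \<Longrightarrow> P y) \<Longrightarrow> P x"
  have wf: "wf ((omega1 - Id))" by (rule WF)
  have "\<forall>a. Rep_countable_ordinal a = r \<longrightarrow> P a" for r
    using wf
  proof (induction r rule: wf_induct_rule)
    case (less r)
    show ?case
    proof (intro allI impI, rule step)
      fix a y assume a: "Rep_countable_ordinal a = r" and "y < a"
      then have "(Rep_countable_ordinal y, r) \<in> omega1 - Id"
        by (auto simp: less_countable_ordinal_def underS_def)
      from less[OF this] show "P y" by simp
    qed
  qed
  then show "P a" by simp
qed

end

lemma countable_lessThan_countable_ordinal: "countable {..<\<alpha> :: countable_ordinal}"
proof -
  have "Rep_countable_ordinal ` {..<\<alpha>} \<subseteq> underS omega1 (Rep_countable_ordinal \<alpha>)"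
    by (auto simp: less_countable_ordinal_def)
  then have "countable (Rep_countable_ordinal ` {..<\<alpha>})"
    using countable_underS_omega1[OF Rep_countable_ordinal] countable_subset by blast
  then show ?thesis
    by (rule countable_image_inj_on) (simp add: inj_on_def Rep_countable_ordinal_inject)
qed

lemma countable_atMost_countable_ordinal: "countable {..\<alpha> :: countable_ordinal}"
proof -
  have "{..\<alpha>} = insert \<alpha> {..<\<alpha>}" by (rule set_eqI) (simp add: le_less disj_commute)
  then show ?thesis using countable_lessThan_countable_ordinal[of \<alpha>] by simp
qed

lemma countable_set_strictly_bounded:
  assumes "countable (C :: countable_ordinal set)"
  obtains \<alpha> where "\<forall>x\<in>C. x < \<alpha>"
proof -
  have "countable (\<Union>x\<in>C. {..x})"
    using assms countable_atMost_countable_ordinal by blast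
  moreover have "uncountable (UNIV :: countable_ordinal set)"
    using uncountable_Field_omega1
    by (metis countable_image type_definition.Rep_range type_definition_countable_ordinal)
  ultimately obtain \<alpha> where "\<alpha> \<notin> (\<Union>x\<in>C. {..x})" by (metis UNIV_eq_I)
  then show thesis using that[of \<alpha>] by (auto simp: not_le)
qed

section \<open>Compact well-ordered sets of rationals\<close>

text \<open>
  The enumeration of the rationals serves only to make \<open>wait\<close> positive with finite superlevel sets on
  \<open>\<rat>\<close>.
\<close>

definition wait :: "real \<Rightarrow> real" where
  "wait q = 1 / (1 + real (to_nat_on \<rat> q))"

lemma wait_pos: "0 < wait q" and wait_le_1: "wait q \<le> 1"
  by (auto simp: wait_def)

lemma finite_large_wait:
  assumes "0 < \<epsilon>"
  shows "finite {q \<in> \<rat>. \<epsilon> \<le> wait q}"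
proof -
  obtain N :: nat where N: "1 / \<epsilon> < real N" using reals_Archimedean2 by blast
  have "to_nat_on \<rat> q < N" if "\<epsilon> \<le> wait q" for q :: real
  proof -
    have "1 + real (to_nat_on \<rat> q) \<le> 1 / \<epsilon>"
      using that assms by (simp add: wait_def field_simps)
    with N show ?thesis by linarith
  qed
  then have "to_nat_on \<rat> ` {q \<in> \<rat>. \<epsilon> \<le> wait q} \<subseteq> {..<N}" by auto
  then have "finite (to_nat_on \<rat> ` {q \<in> \<rat>. \<epsilon> \<le> wait q})"
    using finite_subset by blast
  then show ?thesis
    by (rule finite_imageD)
      (auto intro: inj_on_subset[OF inj_on_to_nat_on[OF countable_rat]])
qed

text \<open>An interval contains infinitely many rationals, and only finitely many of them have a long wait.\<close>

lemma rational_with_short_wait: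
  assumes "l < u"
  obtains q where "q \<in> \<rat>" "l < q" "q + wait q < u"
proof -
  define m where "m = (l + u) / 2"
  have lm: "l < m" "m < u" using assms by (auto simp: m_def)
  have "infinite ({l<..<m} \<inter> \<rat>)"
  proof
    assume fin: "finite ({l<..<m} \<inter> \<rat>)"
    obtain q where q: "q \<in> \<rat>" "l < q" "q < m" using Rats_dense_in_real[OF lm(1)] by blast
    let ?n = "Min ({l<..<m} \<inter> \<rat>)"
    have ne: "{l<..<m} \<inter> \<rat> \<noteq> {}" using q by auto
    have "?n \<in> {l<..<m} \<inter> \<rat>" using Min_in[OF fin ne] .
    then obtain p where p: "p \<in> \<rat>" "l < p" "p < ?n" "?n < m" using Rats_dense_in_real[of l ?n] by auto
    then have "?n \<le> p" using Min_le[OF fin, of p] by auto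
    then show False using p by simp
  qed
  moreover have "finite {q \<in> \<rat>. u - m \<le> wait q}"
    using finite_large_wait lm by simp
  ultimately have "\<not> {l<..<m} \<inter> \<rat> \<subseteq> {q \<in> \<rat>. u - m \<le> wait q}"
    using finite_subset by blast
  then obtain q where "q \<in> \<rat>" "l < q" "q < m" "wait q < u - m" by force
  then show thesis using that by force
qed

text \<open>
  Rationality makes \<open>s \<mapsto> Sup s\<close> a map into a countable set that is strictly increasing along
  branches, so no branch of the tree is uncountable. The gap condition reserves the interval from \<open>a\<close> to
  \<open>a + wait a\<close> for separating the branches that leave the tree at \<open>a\<close>.
\<close>

definition node :: "real set \<Rightarrow> bool" where
  "node s \<longleftrightarrow> compact s \<and> s \<subseteq> \<rat> \<and> 0 \<in> s \<and> s \<subseteq> {0..} \<and>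
     (\<forall>a\<in>s. \<forall>a'\<in>s. a < a' \<longrightarrow> a + wait a \<le> a')"

lemma node_gap: "node s \<Longrightarrow> a \<in> s \<Longrightarrow> a' \<in> s \<Longrightarrow> a < a' \<Longrightarrow> a + wait a \<le> a'"
  by (simp add: node_def)

lemma node_Sup_in: "node s \<Longrightarrow> Sup s \<in> s"
  unfolding node_def by (metis closed_contains_Sup compact_imp_closed bounded_imp_bdd_above
      compact_imp_bounded empty_iff)

lemma node_le_Sup: "node s \<Longrightarrow> a \<in> s \<Longrightarrow> a \<le> Sup s"
  unfolding node_def by (meson bounded_imp_bdd_above compact_imp_bounded cSup_upper)

lemma Sup_Int_atMost: "a \<in> s \<Longrightarrow> Sup (s \<inter> {..a}) = (a :: real)"
  by (rule cSup_eq_maximum) auto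

lemma Int_Sup_eq: "node s \<Longrightarrow> s \<inter> {..Sup s} = s"
  using node_le_Sup by blast

text \<open>
  Nodes are well-ordered: by compactness the infimum of a subset belongs to the node, and the gap above it
  excludes that it is only approximated by the subset.
\<close>

lemma node_least:
  assumes "node s" "S \<subseteq> s" "S \<noteq> {}"
  shows "Inf S \<in> S" "\<And>x. x \<in> S \<Longrightarrow> Inf S \<le> x"
proof -
  have bdd: "bdd_below S" using assms unfolding node_def by (meson atLeast_iff bdd_below.I subset_iff)
  show le: "\<And>x. x \<in> S \<Longrightarrow> Inf S \<le> x" using bdd by (simp add: cInf_lower)
  show "Inf S \<in> S"
  proof (rule ccontr)
    assume n: "Inf S \<notin> S"
    have "closure S \<subseteq> s" using assms(1,2) unfolding node_def
      by (meson closure_minimal compact_imp_closed)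
    then have i: "Inf S \<in> s" using closure_contains_Inf[OF assms(3) bdd] by blast
    obtain x where x: "x \<in> S" "x < Inf S + wait (Inf S)"
      using cInf_lessD[OF assms(3), of "Inf S + wait (Inf S)"] wait_pos by auto
    then have "Inf S < x" using le n by (metis order_le_less)
    then show False using node_gap[OF assms(1) i, of x] x assms(2) by auto
  qed
qed

lemma node_closed_below:
  assumes "node s" "a \<in> s" "S \<subseteq> s" "S \<noteq> {}" "\<And>x. x \<in> s \<Longrightarrow> x < a \<Longrightarrow> x \<in> S" "\<And>x. x \<in> S \<Longrightarrow> x < a"
     "\<not> (\<exists>m\<in>S. \<forall>x\<in>S. x \<le> m)"
  shows "a = Sup S"
proof -
  have bdd: "bdd_above S" using assms(6) by (meson bdd_above.I less_imp_le)
  have "closure S \<subseteq> s" using assms(1,3) unfolding node_def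
    by (meson closure_minimal compact_imp_closed)
  then have i: "Sup S \<in> s" using closure_contains_Sup[OF assms(4) bdd] by blast
  have "Sup S \<le> a" using assms(4,6) by (meson cSup_least less_imp_le)
  moreover have "\<not> Sup S < a"
  proof
    assume "Sup S < a"
    then have "Sup S \<in> S" using i assms(5) by blast
    then show False using assms(7) bdd by (meson cSup_upper)
  qed
  ultimately show ?thesis by simp
qed

text \<open>
  The tree is Hausdorff: two nodes have a largest common initial segment with a maximum. If the common
  part \<open>C\<close> had no maximum, then in both nodes the next point would be the limit \<open>Sup C\<close>, which would
  then be common as well.
\<close>

lemma node_meet:
  assumes s: "node s" and t: "node t"
  obtains c where "c \<in> s" "c \<in> t" "s \<inter> {..c} = t \<inter> {..c}"
    "\<And>d. d \<in> s \<Longrightarrow> d \<in> t \<Longrightarrow> s \<inter> {..d} = t \<inter> {..d} \<Longrightarrow> d \<le> c"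
proof -
  define C where "C = {x. x \<in> s \<and> x \<in> t \<and> s \<inter> {..x} = t \<inter> {..x}}"
  have C0: "0 \<in> C" using s t by (auto simp: C_def node_def)
  have dcl: "x \<in> C" if "y \<in> C" "x \<le> y" "x \<in> s \<or> x \<in> t" for x y
  proof -
    have eq: "s \<inter> {..y} = t \<inter> {..y}" using that(1) by (simp add: C_def)
    have "w \<inter> {..x} = (w \<inter> {..y}) \<inter> {..x}" for w using that(2) by auto
    then have "s \<inter> {..x} = t \<inter> {..x}" using eq by metis
    moreover have "x \<in> s \<longleftrightarrow> x \<in> t" using eq that(2) by blast
    ultimately show ?thesis using that(3) by (auto simp: C_def)
  qed
  have "\<exists>m\<in>C. \<forall>x\<in>C. x \<le> m"
  proof (rule ccontr)
    assume no: "\<not> (\<exists>m\<in>C. \<forall>x\<in>C. x \<le> m)"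
    have step: "Sup C \<in> w \<and> w \<inter> {..<Sup C} = C" if w: "node w" "w = s \<or> w = t" for w
    proof -
      have Cw: "C \<subseteq> w" using w by (auto simp: C_def)
      have "Sup w \<notin> C" using no node_le_Sup[OF w(1)] Cw by blast
      then have ne: "w - C \<noteq> {}" using node_Sup_in[OF w(1)] by blast
      define a where "a = Inf (w - C)"
      have a: "a \<in> w" "a \<notin> C" "\<And>x. x \<in> w - C \<Longrightarrow> a \<le> x"
        using node_least[OF w(1) _ ne] by (auto simp: a_def)
      have lt: "x < a" if "x \<in> C" for x
        using dcl[OF that, of a] a w by (metis not_le)
      have in_C: "x \<in> C" if "x \<in> w" "x < a" for x using a(3)[of x] that by auto
      have "a = Sup C" using node_closed_below[OF w(1) a(1) Cw _ in_C lt no] C0 by auto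
      then show ?thesis using a(1) lt in_C Cw by auto
    qed
    have "s \<inter> {..Sup C} = t \<inter> {..Sup C}"
    proof -
      have eq: "w \<inter> {..Sup C} = insert (Sup C) C" if "w = s \<or> w = t" for w
      proof -
        have "node w" using that s t by auto
        then have 1: "Sup C \<in> w" "w \<inter> {..<Sup C} = C" using step[of w] that by auto
        then show ?thesis unfolding ivl_disj_un(2)[symmetric] by auto
      qed
      show ?thesis using eq[of s] eq[of t] by simp
    qed
    then have "Sup C \<in> C" using step[OF s] step[OF t] by (simp add: C_def)
    then show False using no step[OF s] by (metis IntD2 lessThan_iff order_less_irrefl)
  qed
  then show thesis using that unfolding C_def by blast
qed

section \<open>A tree with countable levels\<close>

text \<open>
  The proper initial segments of \<open>s\<close> lie on the levels below \<open>\<alpha>\<close>, and every such level contains one of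
  them. So \<open>s\<close> has order type \<open>\<alpha> + 1\<close>, expressed through the levels that have been chosen before.
\<close>

definition fits :: "(countable_ordinal \<Rightarrow> real set set) \<Rightarrow> countable_ordinal \<Rightarrow> real set \<Rightarrow> bool" where
  "fits L \<alpha> s \<longleftrightarrow> node s \<and>
     (\<forall>a\<in>s. a < Sup s \<longrightarrow> (\<exists>\<beta><\<alpha>. s \<inter> {..a} \<in> L \<beta>)) \<and>
     (\<forall>\<beta><\<alpha>. \<exists>a\<in>s. a < Sup s \<and> s \<inter> {..a} \<in> L \<beta>)"

text \<open>
  The extension property is what keeps the recursion going: an arbitrary node on a lower level can be
  continued to this level with every prescribed rational maximum that leaves room for its gap.
\<close>

definition level :: "(countable_ordinal \<Rightarrow> real set set) \<Rightarrow> countable_ordinal \<Rightarrow> real set set \<Rightarrow> bool" where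
  "level L \<alpha> S \<longleftrightarrow> countable S \<and> (\<forall>s\<in>S. fits L \<alpha> s) \<and>
     (\<forall>\<beta><\<alpha>. \<forall>t\<in>L \<beta>. \<forall>q\<in>\<rat>. Sup t + wait (Sup t) < q \<longrightarrow>
        (\<exists>s\<in>S. s \<inter> {..Sup t} = t \<and> Sup s = q)) \<and>
     ((\<forall>\<beta>. \<not> \<beta> < \<alpha>) \<longrightarrow> {0} \<in> S)"

lemma fits_insert:
  assumes t: "fits L \<gamma> t" "t \<in> L \<gamma>" and q: "q \<in> \<rat>" "Sup t + wait (Sup t) < q"
    and \<gamma>: "\<gamma> < \<alpha>" "\<And>\<beta>. \<beta> < \<alpha> \<Longrightarrow> \<beta> \<le> \<gamma>"
  shows "fits L \<alpha> (insert q t)" "Sup (insert q t) = q" "a \<le> Sup t \<Longrightarrow> insert q t \<inter> {..a} = t \<inter> {..a}"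
proof -
  have nt: "node t" using t by (simp add: fits_def)
  have lt: "Sup t < q" using q(2) wait_pos[of "Sup t"] by linarith
  have le: "a \<le> Sup t" if "a \<in> t" for a using node_le_Sup[OF nt that] .
  have "node (insert q t)" unfolding node_def
  proof (intro conjI ballI impI)
    show "compact (insert q t)" using nt by (simp add: node_def)
    show "insert q t \<subseteq> \<rat>" "0 \<in> insert q t" using nt q by (auto simp: node_def)
    show "insert q t \<subseteq> {0..}" using nt lt le[of 0] by (auto simp: node_def)
    fix a a' assume a: "a \<in> insert q t" "a' \<in> insert q t" "a < a'"
    then have "a \<in> t" using le[of a'] lt by auto
    show "a + wait a \<le> a'"
    proof (cases "a' = q")
      case True
      show ?thesis
      proof (cases "a = Sup t")
        case True
        then show ?thesis using q \<open>a' = q\<close> by simp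
      next
        case False
        then have "a + wait a \<le> Sup t"
          using node_gap[OF nt \<open>a \<in> t\<close> node_Sup_in[OF nt]] le[OF \<open>a \<in> t\<close>] by simp
        then show ?thesis using lt \<open>a' = q\<close> by simp
      qed
    next
      case False
      then show ?thesis using node_gap[OF nt \<open>a \<in> t\<close>] a by auto
    qed
  qed
  have leq: "x \<le> q" if "x \<in> insert q t" for x using that le[of x] lt by auto
  show sup: "Sup (insert q t) = q"
    by (rule cSup_eq_maximum) (use leq in auto)
  show seg: "insert q t \<inter> {..a} = t \<inter> {..a}" if "a \<le> Sup t" for a
    using lt that by auto
  have segL: "\<exists>\<beta>. \<beta> < \<alpha> \<and> insert q t \<inter> {..a} \<in> L \<beta>" if "a \<in> insert q t" "a < q" for a
  proof (cases "a = Sup t")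
    case True
    then have "insert q t \<inter> {..a} = t" using seg[of a] Int_Sup_eq[OF nt] by simp
    then show ?thesis using t(2) \<gamma>(1) by metis
  next
    case False
    have a: "a \<in> t" using that by simp
    with False obtain \<beta> where "\<beta> < \<gamma>" "t \<inter> {..a} \<in> L \<beta>"
      using t(1) le[OF a] unfolding fits_def by (meson order_le_less)
    then show ?thesis using seg[of a] le[OF a] \<gamma>(1) by (metis less_trans)
  qed
  have Lseg: "\<exists>a\<in>insert q t. a < q \<and> insert q t \<inter> {..a} \<in> L \<beta>" if "\<beta> < \<alpha>" for \<beta>
  proof (cases "\<beta> = \<gamma>")
    case True
    then show ?thesis using seg[of "Sup t"] Int_Sup_eq[OF nt] t(2) node_Sup_in[OF nt] lt
      by (intro bexI[of _ "Sup t"]) auto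
  next
    case False
    then have "\<beta> < \<gamma>" using \<gamma>(2)[OF that] by simp
    then obtain a where "a \<in> t" "t \<inter> {..a} \<in> L \<beta>"
      using t(1) unfolding fits_def by meson
    then show ?thesis using seg[of a] le[of a] lt by (intro bexI[of _ a]) auto
  qed
  show "fits L \<alpha> (insert q t)"
    unfolding fits_def sup using \<open>node (insert q t)\<close> segL Lseg by blast
qed

text \<open>
  The union of an increasing chain of nodes is not closed. It becomes a node when the limit \<open>q\<close> of the
  maxima is added, which is possible because the maxima have been steered to a rational \<open>q\<close>.
\<close>

lemma fits_limit:
  assumes t: "\<And>n. fits L (\<beta> n) (t n)" "\<And>n. t n \<in> L (\<beta> n)" and \<beta>: "\<And>n. \<beta> n < \<alpha>"
    and seg: "\<And>n. t (Suc n) \<inter> {..Sup (t n)} = t n"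
    and lt: "\<And>n. Sup (t n) < Sup (t (Suc n))" "\<And>n. Sup (t n) < q" and q: "q \<in> \<rat>" "\<And>x. x < q \<Longrightarrow> \<exists>n. x < Sup (t n)"
    and cofinal: "\<And>\<gamma>. \<gamma> < \<alpha> \<Longrightarrow> \<exists>n. \<gamma> \<le> \<beta> n"
  defines "s \<equiv> insert q (\<Union>n. t n)"
  shows "fits L \<alpha> s" "Sup s = q" "s \<inter> {..Sup (t n)} = t n"
proof -
  have nt: "node (t n)" for n using t by (simp add: fits_def)
  have le: "a \<le> Sup (t n)" if "a \<in> t n" for a n using node_le_Sup[OF nt that] .
  have mono: "Sup (t i) \<le> Sup (t j)" if "i \<le> j" for i j
    by (rule lift_Suc_mono_le[of "\<lambda>n. Sup (t n)", OF less_imp_le[OF lt(1)] that])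
  have seg': "t j \<inter> {..Sup (t i)} = t i" if "i \<le> j" for i j
    using that
  proof (induction j rule: dec_induct)
    case base
    then show ?case using Int_Sup_eq[OF nt] by simp
  next
    case (step j)
    have "t (Suc j) \<inter> {..Sup (t i)} = (t (Suc j) \<inter> {..Sup (t j)}) \<inter> {..Sup (t i)}"
      using mono[OF step(1)] by auto
    then show ?case using step seg by simp
  qed
  show sseg: "s \<inter> {..Sup (t n)} = t n" for n
  proof (rule set_eqI)
    fix x
    have "x \<in> t n" if "x \<in> t j" "x \<le> Sup (t n)" for j
      using seg'[of n j] seg'[of j n] that by (cases "n \<le> j") auto
    then show "x \<in> s \<inter> {..Sup (t n)} \<longleftrightarrow> x \<in> t n"
      using le[of x n] lt(2)[of n] unfolding s_def by auto
  qed
  have slt: "\<exists>n. x \<in> t n" if "x \<in> s" "x < q" for x using that by (auto simp: s_def)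
  have sle: "x \<le> q" if x: "x \<in> s" for x
  proof (cases "x = q")
    case False
    then obtain n where "x \<in> t n" using x by (auto simp: s_def)
    then show ?thesis using le[of x n] lt(2)[of n] by simp
  qed simp
  have s0: "0 \<le> x" if "x \<in> s" for x
  proof -
    have "0 \<in> t 0" using nt[of 0] by (simp add: node_def)
    then have "0 \<le> q" using le[of 0 0] lt(2)[of 0] by simp
    then show ?thesis using that nt unfolding s_def node_def by blast
  qed
  have "closed s"
    unfolding closure_subset_eq[symmetric]
  proof
    fix x assume x: "x \<in> closure s"
    have "closure s \<subseteq> {..q}" using sle by (intro closure_minimal) auto
    then have "x \<le> q" using x by auto
    show "x \<in> s"
    proof (cases "x = q")
      case False
      then obtain n where n: "x < Sup (t n)" using q(2) \<open>x \<le> q\<close> by fastforce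
      have "x \<in> closure ({..<Sup (t n)} \<inter> s)"
        using open_Int_closure_subset[of "{..<Sup (t n)}" s] x n by auto
      also have "\<dots> \<subseteq> closure (s \<inter> {..Sup (t n)})" by (intro closure_mono) auto
      also have "\<dots> = closure (t n)" by (simp only: sseg)
      also have "\<dots> = t n" using nt[of n] by (simp add: node_def compact_imp_closed)
      finally show ?thesis by (auto simp: s_def)
    qed (simp add: s_def)
  qed
  moreover have "bounded s"
    using sle s0 by (intro bounded_subset[OF bounded_closed_interval[of 0 q]]) auto
  ultimately have "compact s" by (simp add: compact_eq_bounded_closed)
  have "node s" unfolding node_def
  proof (intro conjI ballI impI)
    show "compact s" by fact
    show "s \<subseteq> \<rat>" "0 \<in> s" "s \<subseteq> {0..}" using nt q s0 unfolding s_def node_def by blast+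
    fix a a' assume a: "a \<in> s" "a' \<in> s" "a < a'"
    then have "a < q" using sle[of a'] by simp
    then obtain n where n: "a \<in> t n" using slt a by blast
    have "a < Sup (t (Suc n))" using le[OF n] lt(1)[of n] by simp
    show "a + wait a \<le> a'"
    proof (cases "a' = q")
      case True
      have "a \<in> t (Suc n)" using seg[of n] n by blast
      then have "a + wait a \<le> Sup (t (Suc n))"
        using node_gap[OF nt _ node_Sup_in[OF nt]] \<open>a < Sup (t (Suc n))\<close> by blast
      then show ?thesis using lt(2)[of "Suc n"] True by simp
    next
      case False
      then have "a' < q" using sle[of a'] a by simp
      then obtain m where m: "a' \<in> t m" using slt a by blast
      have "a \<in> t (max m n)" "a' \<in> t (max m n)" using seg'[of n "max m n"] seg'[of m "max m n"] m n by (metis IntD1 max.cobounded1 max.cobounded2)+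
      then show ?thesis using node_gap[OF nt] a by blast
    qed
  qed
  show sup: "Sup s = q" by (rule cSup_eq_maximum) (use sle in \<open>auto simp: s_def\<close>)
  have sseg2: "s \<inter> {..a} = t n \<inter> {..a}" if "a \<le> Sup (t n)" for a n
  proof -
    have "s \<inter> {..a} = (s \<inter> {..Sup (t n)}) \<inter> {..a}" using that by auto
    then show ?thesis by (simp only: sseg)
  qed
  have segL: "\<exists>\<gamma>. \<gamma> < \<alpha> \<and> s \<inter> {..a} \<in> L \<gamma>" if a: "a \<in> s" "a < q" for a
  proof -
    obtain n where n: "a \<in> t n" using slt a by blast
    show ?thesis
    proof (cases "a = Sup (t n)")
      case True
      then have "s \<inter> {..a} = t n" using sseg[of n] by simp
      then show ?thesis using t(2) \<beta> by metis
    next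
      case False
      then obtain \<gamma> where "\<gamma> < \<beta> n" "t n \<inter> {..a} \<in> L \<gamma>"
        using t(1)[of n] n le[OF n] unfolding fits_def by (meson order_le_less)
      then show ?thesis using sseg2[OF le[OF n]] \<beta> by (metis less_trans)
    qed
  qed
  have Lseg: "\<exists>a\<in>s. a < q \<and> s \<inter> {..a} \<in> L \<gamma>" if \<gamma>: "\<gamma> < \<alpha>" for \<gamma>
  proof -
    obtain n where n: "\<gamma> \<le> \<beta> n" using cofinal[OF \<gamma>] by blast
    have ts: "t n \<subseteq> s" by (auto simp: s_def)
    show ?thesis
    proof (cases "\<gamma> = \<beta> n")
      case True
      then have "s \<inter> {..Sup (t n)} \<in> L \<gamma>" using sseg[of n] t(2)[of n] by simp
      then show ?thesis using ts node_Sup_in[OF nt[of n]] lt(2)[of n] by blast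
    next
      case False
      then have "\<gamma> < \<beta> n" using n by simp
      then obtain a where "a \<in> t n" "t n \<inter> {..a} \<in> L \<gamma>" using t(1)[of n] unfolding fits_def by meson
      then show ?thesis using sseg2[of a n] le[of a n] lt(2)[of n] ts
        by (intro bexI[of _ a]) auto
    qed
  qed
  show "fits L \<alpha> s" unfolding fits_def sup using \<open>node s\<close> segL Lseg by blast
qed

lemma level_fits: "level L \<alpha> S \<Longrightarrow> s \<in> S \<Longrightarrow> fits L \<alpha> s"
  by (simp add: level_def)

lemma level_extend:
  assumes "level L \<alpha> S" "\<beta> < \<alpha>" "t \<in> L \<beta>" "q \<in> \<rat>" "Sup t + wait (Sup t) < q"
  obtains s where "s \<in> S" "s \<inter> {..Sup t} = t" "Sup s = q"
  using assms unfolding level_def by blast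

text \<open>
  At a limit level, the node is extended along a sequence of levels cofinal in \<open>\<alpha>\<close>, with maxima increasing to
  \<open>q\<close>. At every step the extension property of the earlier levels applies, since rationals with
  arbitrarily small \<open>wait\<close> exist in each interval.
\<close>

lemma fits_extension:
  assumes L: "\<And>\<beta>. \<beta> < \<alpha> \<Longrightarrow> level L \<beta> (L \<beta>)"
    and \<beta>: "\<beta> < \<alpha>" "t \<in> L \<beta>" and q: "q \<in> \<rat>" "Sup t + wait (Sup t) < q"
  shows "\<exists>s. fits L \<alpha> s \<and> s \<inter> {..Sup t} = t \<and> Sup s = q"
proof -
  have step: "\<exists>t'. t' \<in> L \<gamma> \<and> t' \<inter> {..Sup t} = t \<and> Sup t < Sup t' \<and> l < Sup t' \<and> Sup t' + wait (Sup t') < q"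
    if h: "\<beta> < \<gamma>" "\<gamma> < \<alpha>" "t \<in> L \<beta>" "Sup t + wait (Sup t) < q" "l < q" for \<beta> \<gamma> t l
  proof -
    obtain p where p: "p \<in> \<rat>" "max l (Sup t + wait (Sup t)) < p" "p + wait p < q"
      using rational_with_short_wait[of "max l (Sup t + wait (Sup t))" q] h(4,5) by auto
    obtain t' where "t' \<in> L \<gamma>" "t' \<inter> {..Sup t} = t" "Sup t' = p"
      using level_extend[OF L[OF h(2)] h(1,3) p(1)] p(2) by auto
    moreover have "Sup t < p" "l < p" using p(2) wait_pos[of "Sup t"] by auto
    ultimately show ?thesis using p(3) by metis
  qed
  show ?thesis
  proof (cases "\<exists>\<gamma><\<alpha>. \<forall>\<delta><\<alpha>. \<delta> \<le> \<gamma>")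
    case True
    then obtain \<gamma> where \<gamma>: "\<gamma> < \<alpha>" "\<And>\<delta>. \<delta> < \<alpha> \<Longrightarrow> \<delta> \<le> \<gamma>" by blast
    obtain t' where t': "t' \<in> L \<gamma>" "t' \<inter> {..Sup t} = t" "Sup t \<le> Sup t'" "Sup t' + wait (Sup t') < q"
    proof (cases "\<beta> = \<gamma>")
      case True
      have "node t" using level_fits[OF L[OF \<beta>(1)] \<beta>(2)] by (simp add: fits_def)
      then show ?thesis using that[of t] True \<beta> q Int_Sup_eq by auto
    next
      case False
      have "Sup t < q" using q(2) wait_pos[of "Sup t"] by linarith
      then show ?thesis using step[of \<beta> \<gamma> t "Sup t"] that False \<gamma> \<beta> q by fastforce
    qed
    note f = fits_insert[OF level_fits[OF L[OF \<gamma>(1)] t'(1)] t'(1) q(1) t'(4) \<gamma>]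
    show ?thesis using f(1,2) f(3)[of "Sup t"] t'(2,3) by metis
  next
    case False
    then have lim: "\<exists>\<delta><\<alpha>. \<gamma> < \<delta>" if "\<gamma> < \<alpha>" for \<gamma> using that by (meson not_le)
    obtain g :: "nat \<Rightarrow> countable_ordinal" where g: "range g = {..<\<alpha>}"
      using countable_lessThan_countable_ordinal[of \<alpha>] \<beta>(1) uncountable_def by blast
    \<comment> \<open>\<open>f n\<close> is a level together with a node on it; \<open>g\<close> enumerates the levels below \<open>\<alpha>\<close>, so that
      overtaking \<open>g n\<close> at step \<open>n\<close> makes the levels cofinal.\<close>
    have "\<exists>f. \<forall>n. (fst (f n) < \<alpha> \<and> snd (f n) \<in> L (fst (f n)) \<and> Sup (snd (f n)) + wait (Sup (snd (f n))) < q
         \<and> (n = 0 \<longrightarrow> snd (f n) = t))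
       \<and> (g n \<le> fst (f (Suc n)) \<and> snd (f (Suc n)) \<inter> {..Sup (snd (f n))} = snd (f n) \<and> Sup (snd (f n)) < Sup (snd (f (Suc n)))
          \<and> q - 1 / real (Suc n) < Sup (snd (f (Suc n))))"
    proof (rule dependent_nat_choice, goal_cases)
      case 1
      then show ?case using \<beta> q by (intro exI[of _ "(\<beta>, t)"]) auto
    next
      case (2 x n)
      have "g n < \<alpha>" using g by auto
      then obtain \<gamma> where \<gamma>: "\<gamma> < \<alpha>" "max (g n) (fst x) < \<gamma>" using lim[of "max (g n) (fst x)"] 2 by auto
      obtain t' where "t' \<in> L \<gamma> \<and> t' \<inter> {..Sup (snd x)} = snd x \<and> Sup (snd x) < Sup t' \<and> q - 1 / real (Suc n) < Sup t'
         \<and> Sup t' + wait (Sup t') < q"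
        using step[of "fst x" \<gamma> "snd x" "q - 1 / real (Suc n)"] 2 \<gamma> by auto
      then show ?case using \<gamma> by (intro exI[of _ "(\<gamma>, t')"]) auto
    qed
    then obtain f where f: "\<And>n. fst (f n) < \<alpha>" "\<And>n. snd (f n) \<in> L (fst (f n))"
        "\<And>n. Sup (snd (f n)) + wait (Sup (snd (f n))) < q" "snd (f 0) = t" "\<And>n. g n \<le> fst (f (Suc n))"
        "\<And>n. snd (f (Suc n)) \<inter> {..Sup (snd (f n))} = snd (f n)"
        "\<And>n. Sup (snd (f n)) < Sup (snd (f (Suc n)))" "\<And>n. q - 1 / real (Suc n) < Sup (snd (f (Suc n)))"
      by metis
    have appr: "\<exists>n. x < Sup (snd (f n))" if x: "x < q" for x
    proof -
      obtain n where "1 / real (Suc n) < q - x" using nat_approx_posE[of "q - x"] x by auto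
      then show ?thesis using f(8)[of n] by (intro exI[of _ "Suc n"]) linarith
    qed
    have ltq: "Sup (snd (f n)) < q" for n using f(3)[of n] wait_pos[of "Sup (snd (f n))"] by linarith
    have cof: "\<exists>n. \<gamma> \<le> fst (f n)" if \<gamma>: "\<gamma> < \<alpha>" for \<gamma>
    proof -
      obtain n where "\<gamma> = g n" using g \<gamma> by (metis lessThan_iff rangeE)
      then show ?thesis using f(5)[of n] by blast
    qed
    note fl = fits_limit[where t="\<lambda>n. snd (f n)" and \<beta>="\<lambda>n. fst (f n)", OF _ f(2) f(1) f(6) f(7) ltq q(1) appr cof]
    show ?thesis using fl[OF level_fits[OF L[OF f(1)] f(2)]] f(4) by metis
  qed
qed

text \<open>
  One extension is chosen for each of the countably many pairs of a node on a lower level and an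
  admissible maximum, so each level is countable.
\<close>

theorem tree_levels_exist: "\<exists>L. \<forall>\<alpha>. level L \<alpha> (L \<alpha>)"
proof (rule dependent_wf_choice)
  show "wf {(x, y). x < (y :: countable_ordinal)}" by (rule wf)
  show "level f x r = level g x r" if "\<And>z. (z, x) \<in> {(x, y). x < y} \<Longrightarrow> f z = g z" for f g x r
  proof -
    have "f z = g z" if "z < x" for z using that \<open>\<And>z. (z, x) \<in> {(x, y). x < y} \<Longrightarrow> f z = g z\<close> by simp
    then show ?thesis unfolding level_def fits_def by (simp cong: conj_cong)
  qed
  fix \<alpha> L
  assume "\<And>y. (y, \<alpha>) \<in> {(x, y). x < y} \<Longrightarrow> level L y (L y)"
  then have L: "level L \<beta> (L \<beta>)" if "\<beta> < \<alpha>" for \<beta> using that by simp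
  define I where "I = {(t, q). \<exists>\<beta><\<alpha>. t \<in> L \<beta> \<and> q \<in> \<rat> \<and> Sup t + wait (Sup t) < q}"
  have "\<forall>x\<in>I. \<exists>s. fits L \<alpha> s \<and> s \<inter> {..Sup (fst x)} = fst x \<and> Sup s = snd x"
    using fits_extension[OF L] unfolding I_def by auto
  then obtain e where e: "\<And>x. x \<in> I \<Longrightarrow> fits L \<alpha> (e x) \<and> e x \<inter> {..Sup (fst x)} = fst x \<and> Sup (e x) = snd x"
    by metis
  have "countable I"
  proof (rule countable_subset)
    show "I \<subseteq> (\<Union>\<beta>\<in>{..<\<alpha>}. L \<beta>) \<times> \<rat>" by (auto simp: I_def)
    show "countable ((\<Union>\<beta>\<in>{..<\<alpha>}. L \<beta>) \<times> \<rat>)"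
      using L countable_lessThan_countable_ordinal countable_rat
      by (intro countable_SIGMA countable_UN) (auto simp: level_def)
  qed
  have fits0: "fits L \<alpha> {0}" if "\<forall>\<beta>. \<not> \<beta> < \<alpha>" using that by (auto simp: fits_def node_def)
  show "\<exists>S. level L \<alpha> S"
  proof
    let ?S = "e ` I \<union> (if \<forall>\<beta>. \<not> \<beta> < \<alpha> then {{0}} else {})"
    show "level L \<alpha> ?S"
      unfolding level_def
    proof (intro conjI allI ballI impI)
      show "countable ?S" using \<open>countable I\<close> by auto
      show "fits L \<alpha> s" if "s \<in> ?S" for s using that e fits0 by (auto split: if_splits)
      show "{0} \<in> ?S" if "\<forall>\<beta>. \<not> \<beta> < \<alpha>" using that by auto
      fix \<beta> t q assume "\<beta> < \<alpha>" "t \<in> L \<beta>" "q \<in> \<rat>" "Sup t + wait (Sup t) < q"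
      then have "(t, q) \<in> I" by (auto simp: I_def)
      then show "\<exists>s\<in>?S. s \<inter> {..Sup t} = t \<and> Sup s = q" using e[of "(t, q)"] by (intro bexI[of _ "e (t, q)"]) auto
    qed
  qed
qed

text \<open>
  Levels are comparable along a branch. A counterexample \<open>s\<close> on the least possible level has a segment
  that lies on two levels \<open>\<gamma> < \<beta>\<close>; this segment is then a counterexample on the lower level \<open>\<gamma>\<close>.
\<close>

lemma level_of_segment:
  assumes L: "\<And>\<alpha>. level L \<alpha> (L \<alpha>)"
  shows "s \<in> L \<alpha> \<Longrightarrow> a \<in> s \<Longrightarrow> a < Sup s \<Longrightarrow> s \<inter> {..a} \<in> L \<beta> \<Longrightarrow> \<beta> < \<alpha>"
proof (induction \<alpha> arbitrary: s a \<beta> rule: less_induct)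
  case (less \<alpha>)
  have fit: "fits L \<alpha> s" using level_fits[OF L less.prems(1)] .
  then obtain \<gamma> where \<gamma>: "\<gamma> < \<alpha>" "s \<inter> {..a} \<in> L \<gamma>" using less.prems unfolding fits_def by blast
  show ?case
  proof (rule ccontr)
    assume "\<not> \<beta> < \<alpha>"
    then have "\<gamma> < \<beta>" using \<gamma> by auto
    then obtain d where d: "d \<in> s \<inter> {..a}" "d < Sup (s \<inter> {..a})" "s \<inter> {..a} \<inter> {..d} \<in> L \<gamma>"
      using level_fits[OF L less.prems(4)] unfolding fits_def by blast
    show False using less.IH[OF \<gamma> d] by simp
  qed
qed

lemma level_unique:
  assumes L: "\<And>\<alpha>. level L \<alpha> (L \<alpha>)" and "s \<in> L \<alpha>" "s \<in> L \<beta>"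
  shows "\<alpha> = \<beta>"
proof -
  have "\<not> \<alpha> < \<beta>" if s: "s \<in> L \<alpha>" "s \<in> L \<beta>" for \<alpha> \<beta>
  proof
    assume "\<alpha> < \<beta>"
    then obtain a where "a \<in> s" "a < Sup s" "s \<inter> {..a} \<in> L \<alpha>"
      using level_fits[OF L s(2)] unfolding fits_def by blast
    then show False using level_of_segment[OF L s(1)] by blast
  qed
  then show ?thesis using assms by (metis linorder_neqE)
qed

lemma level_root:
  assumes "\<And>\<alpha>. level L \<alpha> (L \<alpha>)"
  shows "{0} \<in> L (LEAST \<alpha>. True)"
proof -
  have "\<not> \<beta> < (LEAST \<alpha>. True)" for \<beta> :: countable_ordinal
    using not_less_Least by blast
  then show ?thesis using assms[of "LEAST \<alpha>. True"] by (simp add: level_def)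
qed

lemma level_nonempty:
  assumes L: "\<And>\<alpha>. level L \<alpha> (L \<alpha>)"
  shows "L \<alpha> \<noteq> {}"
proof (cases "(LEAST \<alpha>. True) < \<alpha>")
  case True
  have "wait 0 < 2" using wait_le_1[of 0] by simp
  then show ?thesis using level_extend[OF L True level_root[OF L], of 2] by auto
next
  case False
  then have "\<alpha> = (LEAST \<alpha>. True)" by (metis (full_types) Least_le linorder_neqE not_less)
  then show ?thesis using level_root[OF L] by auto
qed

section \<open>Connected locally separable metrizable spaces\<close>

text \<open>
  Starting from one point, repeatedly add countable dense subsets of all separable balls with radius
  \<open>1/(n+1)\<close> around the points found so far. The closure of the resulting countable set is open: a point
  \<open>x\<close> of it is so close to some point \<open>y\<close> of the set that a ball around \<open>y\<close> which contains \<open>x\<close> lies in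
  a separable ball around \<open>x\<close>.
\<close>

lemma connected_locally_separable_metrizable_imp_separable:
  assumes met: "metrizable_space X" and conn: "connected_space X"
    and loc: "\<And>x. x \<in> topspace X \<Longrightarrow> \<exists>U D. openin X U \<and> x \<in> U \<and> countable D \<and> D \<subseteq> topspace X \<and> U \<subseteq> X closure_of D"
  obtains D where "countable D" "D \<subseteq> topspace X" "X closure_of D = topspace X"
proof (cases "topspace X = {}")
  case True
  then show ?thesis using that[of "{}"] by simp
next
  case False
  then obtain x0 where x0: "x0 \<in> topspace X" by blast
  obtain M d where "Metric_space M d" and X: "X = Metric_space.mtopology M d"
    using met unfolding metrizable_space_def by blast
  interpret Metric_space M d by fact
  have top: "topspace X = M" by (simp add: X)
  define sep where "sep x r D \<longleftrightarrow> countable D \<and> D \<subseteq> M \<and> mball x r \<subseteq> X closure_of D" for x r D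
  define E where "E x r = (SOME D. sep x r D)" for x r
  have E: "sep x r (E x r)" if "sep x r D" for x r D
    unfolding E_def using that by (rule someI)
  define grow where "grow C = C \<union> (\<Union>x\<in>C. \<Union>n\<in>{n::nat. \<exists>D. sep x (1 / real (Suc n)) D}. E x (1 / real (Suc n)))" for C
  define F where "F n = (grow ^^ n) {x0}" for n
  have F: "countable (F n) \<and> F n \<subseteq> M" for n
  proof (induction n)
    case 0
    then show ?case using x0 top by (simp add: F_def)
  next
    case (Suc n)
    have "F (Suc n) = grow (F n)" by (simp add: F_def)
    moreover have *: "countable (E x r)" "E x r \<subseteq> M" if "\<exists>D. sep x r D" for x r
    proof -
      have "sep x r (E x r)" using that E by (elim exE) (rule E)
      then show "countable (E x r)" "E x r \<subseteq> M" by (simp_all add: sep_def)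
    qed
    have "countable (grow (F n))" unfolding grow_def
      using Suc *(1) by (intro countable_Un countable_UN) auto
    moreover have "grow (F n) \<subseteq> M" unfolding grow_def using Suc *(2) by (intro Un_least UN_least) auto
    ultimately show ?case by simp
  qed
  define D where "D = (\<Union>n. F n)"
  have D: "countable D" "D \<subseteq> M" using F unfolding D_def by auto
  have "openin X (X closure_of D)"
    unfolding X openin_mtopology
  proof (intro conjI allI impI)
    show clM: "mtopology closure_of D \<subseteq> M" using closure_of_subset_topspace[of mtopology D] by simp
    fix x assume x: "x \<in> mtopology closure_of D"
    then have xM: "x \<in> M" using clM by blast
    obtain U D' where U: "openin X U" "x \<in> U" "countable D'" "D' \<subseteq> M" "U \<subseteq> X closure_of D'"
      using loc[of x] xM top by auto
    then obtain r where r: "r > 0" "mball x r \<subseteq> U" unfolding X openin_mtopology by blast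
    then obtain n where n: "1 / real (Suc n) < r / 2" using nat_approx_posE[of "r / 2"] by auto
    define \<epsilon> where "\<epsilon> = 1 / real (Suc n)"
    have \<epsilon>: "0 < \<epsilon>" "2 * \<epsilon> < r" using n by (auto simp: \<epsilon>_def)
    obtain y where y: "y \<in> D" "y \<in> mball x \<epsilon>"
      using x \<epsilon>(1) unfolding metric_closure_of by (auto simp: mball_def)
    have yM: "y \<in> M" "d x y < \<epsilon>" using y(2) by auto
    have "mball y \<epsilon> \<subseteq> mball x r"
      using yM xM \<epsilon> triangle[of x y] by fastforce
    then have "sep y \<epsilon> D'" unfolding sep_def using U r by auto
    then have sepE: "sep y \<epsilon> (E y \<epsilon>)" by (rule E)
    obtain k where "y \<in> F k" using y(1) by (auto simp: D_def)
    then have "E y \<epsilon> \<subseteq> F (Suc k)" using \<open>sep y \<epsilon> D'\<close>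
      unfolding F_def \<epsilon>_def by (auto simp: grow_def)
    then have "E y \<epsilon> \<subseteq> D" by (auto simp: D_def)
    then have "mball y \<epsilon> \<subseteq> X closure_of D"
      using sepE closure_of_mono unfolding sep_def by blast
    moreover have "x \<in> mball y \<epsilon>" using yM xM commute[of x y] by simp
    ultimately show "\<exists>r>0. mball x r \<subseteq> mtopology closure_of D"
      using openin_mball[of y \<epsilon>] unfolding openin_mtopology X by (meson order_trans)
  qed
  moreover have "x0 \<in> X closure_of D"
  proof -
    have "x0 \<in> F 0" by (simp add: F_def)
    then have "x0 \<in> D" by (auto simp: D_def)
    then show ?thesis using closure_of_subset[of D X] D top by auto
  qed
  ultimately have "X closure_of D = topspace X"
    using conn closedin_closure_of unfolding connected_space_clopen_in by blast
  then show ?thesis using that D top by blast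
qed

section \<open>Stages, bumps and twists\<close>

definition ht :: "real set \<Rightarrow> real" where
  "ht s = Sup s + wait (Sup s)"

text \<open>
  At height \<open>y\<close> a branch through \<open>s\<close> has passed exactly the separations at the points \<open>a\<close> with
  \<open>a + wait a \<le> y\<close>. The point at which it separates next is \<open>stage s y\<close>, and the position in the branching
  base space is recorded by the node \<open>s \<inter> {..stage s y}\<close>.
\<close>

definition stage :: "real set \<Rightarrow> real \<Rightarrow> real" where
  "stage s y = Inf {a \<in> s. y < a + wait a}"

definition bump :: "real \<Rightarrow> real \<Rightarrow> real" where
  "bump a y = max 0 ((y - a) / (a + wait a - y))"

text \<open>
  The next element of \<open>s\<close> distinguishes the branches that leave the tree at \<open>a\<close>. Elements of nodes
  after \<open>a\<close> are positive, so the value \<open>0\<close> at the maximum differs from all of them, and it makes the twist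
  of a node vanish on its own top stage.
\<close>

definition succ_in :: "real set \<Rightarrow> real \<Rightarrow> real" where
  "succ_in s a = (if \<exists>x\<in>s. a < x then Inf {x \<in> s. a < x} else 0)"

text \<open>
  The shift between the chart of \<open>s\<close> and the coordinate in which the points are stored; charts of different
  nodes differ by differences of twists.
\<close>

definition twist :: "real set \<Rightarrow> real \<Rightarrow> real" where
  "twist s y = succ_in s (stage s y) * bump (stage s y) y"

lemma wait_le_ht:
  assumes "node s" "a \<in> s"
  shows "a + wait a \<le> ht s"
  using node_gap[OF assms node_Sup_in] node_le_Sup[OF assms] assms(1) wait_pos[of "Sup s"]
  unfolding ht_def by (cases "a = Sup s") auto

lemma stage:
  assumes "node s" "y < ht s"
  shows "stage s y \<in> s" "y < stage s y + wait (stage s y)"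
proof -
  have "{a \<in> s. y < a + wait a} \<noteq> {}" using assms node_Sup_in[of s] unfolding ht_def by blast
  from node_least(1)[OF assms(1) _ this]
  show "stage s y \<in> s" "y < stage s y + wait (stage s y)" unfolding stage_def by auto
qed

lemma stage_le:
  assumes "node s" "a \<in> s" "y < a + wait a"
  shows "stage s y \<le> a"
  unfolding stage_def by (rule node_least(2)[OF assms(1)]) (use assms in auto)

lemma stage_eqI:
  assumes "node s" "a \<in> s" "y < a + wait a" "\<And>b. b \<in> s \<Longrightarrow> b < a \<Longrightarrow> b + wait b \<le> y"
  shows "stage s y = a"
proof (rule antisym)
  show "stage s y \<le> a" using stage_le assms by blast
  have "y < ht s" using wait_le_ht[OF assms(1,2)] assms(3) by simp
  from stage[OF assms(1) this] show "a \<le> stage s y" using assms(4)[of "stage s y"] by fastforce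
qed

lemma below_stage: "node s \<Longrightarrow> b \<in> s \<Longrightarrow> b < stage s y \<Longrightarrow> b + wait b \<le> y"
  using stage_le[of s b y] by fastforce

text \<open>Nodes with a common initial segment have the same history below the separation at its maximum.\<close>

lemma stage_agree:
  assumes "node s" "node t" and c: "c \<in> s" "c \<in> t" "s \<inter> {..c} = t \<inter> {..c}" and y: "y < c + wait c"
  shows "stage t y = stage s y"
proof -
  have le: "stage s y \<le> c" using stage_le assms by blast
  have ys: "y < ht s" using wait_le_ht[OF assms(1) c(1)] y by simp
  have "stage s y \<in> t" using stage(1)[OF assms(1) ys] le c by blast
  then show ?thesis
  proof (rule stage_eqI[OF assms(2)])
    show "y < stage s y + wait (stage s y)" by (rule stage(2)[OF assms(1) ys])
    fix b assume "b \<in> t" "b < stage s y"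
    then have "b \<in> t \<inter> {..c}" using le by simp
    then have "b \<in> s" using c(3) by blast
    then show "b + wait b \<le> y" using below_stage assms(1) \<open>b < stage s y\<close> by blast
  qed
qed

lemma succ_in:
  assumes "node s" "b \<in> s" "a < b"
  shows "succ_in s a \<in> s" "a < succ_in s a" "\<And>x. x \<in> s \<Longrightarrow> a < x \<Longrightarrow> succ_in s a \<le> x"
proof -
  have ne: "{x \<in> s. a < x} \<noteq> {}" using assms by blast
  have eq: "succ_in s a = Inf {x \<in> s. a < x}" unfolding succ_in_def using assms by auto
  show "succ_in s a \<in> s" "a < succ_in s a" "\<And>x. x \<in> s \<Longrightarrow> a < x \<Longrightarrow> succ_in s a \<le> x"
    using node_least[OF assms(1) _ ne] unfolding eq by auto
qed

lemma succ_in_agree: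
  assumes "node s" "node t" and c: "c \<in> s" "c \<in> t" "s \<inter> {..c} = t \<inter> {..c}" and a: "a < c"
  shows "succ_in s a = succ_in t a"
proof (rule antisym)
  have "succ_in s a \<le> c" "succ_in t a \<le> c" using succ_in(3) assms by blast+
  then have "succ_in s a \<in> t" "succ_in t a \<in> s"
    using succ_in(1)[OF assms(1) c(1) a] succ_in(1)[OF assms(2) c(2) a] c by blast+
  then show "succ_in s a \<le> succ_in t a" "succ_in t a \<le> succ_in s a"
    using succ_in(2,3)[OF assms(1) c(1) a] succ_in(2,3)[OF assms(2) c(2) a] by blast+
qed

lemma bump_nonneg: "0 \<le> bump a y"
  by (simp add: bump_def)

lemma bump_eq_0: "y \<le> a \<Longrightarrow> bump a y = 0"
  using wait_pos[of a] divide_nonpos_pos[of "y - a" "a + wait a - y"] by (simp add: bump_def)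

lemma bump_eq: "a \<le> y \<Longrightarrow> y < a + wait a \<Longrightarrow> bump a y = (y - a) / (a + wait a - y)"
  by (simp add: bump_def)

lemma bump_pos: "a < y \<Longrightarrow> y < a + wait a \<Longrightarrow> 0 < bump a y"
  by (simp add: bump_eq)

lemma continuous_on_bump: "continuous_on {..<a + wait a} (bump a)"
  unfolding bump_def by (intro continuous_intros) auto

lemma bump_blows_up:
  obtains \<eta> where "0 < \<eta>" "\<And>y. a + wait a - \<eta> < y \<Longrightarrow> y < a + wait a \<Longrightarrow> K < bump a y"
proof
  let ?\<eta> = "min (wait a / 2) (wait a / (2 * (\<bar>K\<bar> + 1)))"
  show "0 < ?\<eta>" using wait_pos[of a] by simp
  fix y assume y: "a + wait a - ?\<eta> < y" "y < a + wait a"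
  define z where "z = a + wait a - y"
  have z: "0 < z" "z < wait a / 2" "z < wait a / (2 * (\<bar>K\<bar> + 1))" using y by (auto simp: z_def)
  have "z * (\<bar>K\<bar> + 1) < wait a / 2" using z(3) by (simp add: field_simps)
  also have "\<dots> < y - a" using z(2) by (simp add: z_def)
  finally have "\<bar>K\<bar> + 1 < (y - a) / z" using z(1) by (simp add: field_simps)
  moreover have "bump a y = (y - a) / z" using bump_eq[of a y] y z by (simp add: z_def)
  ultimately show "K < bump a y" by linarith
qed

text \<open>
  A twist alone jumps at the end of each stage, but the twists of two nodes cancel at all stages before
  the last common one, because there both nodes continue with the same element. What remains is one
  bump, so that the difference is continuous.
\<close>

lemma twist_diff:
  assumes "node s" "node t" and c: "c \<in> s" "c \<in> t" "s \<inter> {..c} = t \<inter> {..c}" and y: "y < c + wait c"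
  shows "twist s y - twist t y = (succ_in s c - succ_in t c) * bump c y"
proof -
  have eq: "stage t y = stage s y" by (rule stage_agree[OF assms])
  have le: "stage s y \<le> c" using stage_le[OF assms(1) c(1) y] .
  show ?thesis
  proof (cases "stage s y = c")
    case True
    then show ?thesis using eq by (simp add: twist_def algebra_simps)
  next
    case False
    then have lt: "stage s y < c" using le by simp
    have "y < ht s" using wait_le_ht[OF assms(1) c(1)] y by simp
    then have "y \<le> c" using stage[OF assms(1), of y] node_gap[OF assms(1) _ c(1) lt] by fastforce
    then show ?thesis using eq succ_in_agree[OF assms(1-5) lt] bump_eq_0 by (simp add: twist_def)
  qed
qed

section \<open>Gluing half planes along a tree\<close>

text \<open>
  The point \<open>pt s y r\<close> lies over the position at height \<open>y\<close> in the stage of \<open>Sup s\<close>. An abstract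
  injective naming of the points leaves the type of the points open.
\<close>

locale branching_surface =
  fixes T :: "real set set" and pt :: "real set \<Rightarrow> real \<Rightarrow> real \<Rightarrow> 'p"
  assumes T_node: "s \<in> T \<Longrightarrow> node s"
    and T_segment: "s \<in> T \<Longrightarrow> a \<in> s \<Longrightarrow> s \<inter> {..a} \<in> T"
    and T_root: "{0} \<in> T"
    and pt_inj: "s \<in> T \<Longrightarrow> t \<in> T \<Longrightarrow> pt s y r = pt t y' r' \<Longrightarrow> s = t \<and> y = y' \<and> r = r'"
begin

definition strip :: "real set \<Rightarrow> (real \<times> real) set" where
  "strip s = {v. snd v < ht s}"

definition chart :: "real set \<Rightarrow> real \<times> real \<Rightarrow> 'p" where
  "chart s v = pt (s \<inter> {..stage s (snd v)}) (snd v) (fst v + twist s (snd v))"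

lemma open_strip: "open (strip s)"
  unfolding strip_def by (intro open_Collect_less continuous_intros)

text \<open>
  The charts of \<open>s\<close> and \<open>t\<close> overlap exactly below the separation of \<open>s\<close> and \<open>t\<close>, at the maximum \<open>c\<close> of
  their largest common segment. If some height at or above the separation belongs to both half planes, then \<open>s\<close> and
  \<open>t\<close> both continue beyond \<open>c\<close>, with different next elements, and the transition shift is not zero.
\<close>

lemma chart_overlap:
  assumes s: "s \<in> T" and t: "t \<in> T"
  obtains c k where "c \<in> s" "c \<in> t"
    "\<And>v w. v \<in> strip s \<Longrightarrow> w \<in> strip t \<Longrightarrow> chart s v = chart t w \<longleftrightarrow>
       snd v = snd w \<and> snd w < c + wait c \<and> fst v = fst w - k * bump c (snd w)"
    "\<And>y. c + wait c \<le> y \<Longrightarrow> y < ht s \<Longrightarrow> y < ht t \<Longrightarrow> k \<noteq> 0"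
proof -
  have ns: "node s" and nt: "node t" using T_node s t by auto
  obtain c where c: "c \<in> s" "c \<in> t" "s \<inter> {..c} = t \<inter> {..c}"
    and cmax: "\<And>d. d \<in> s \<Longrightarrow> d \<in> t \<Longrightarrow> s \<inter> {..d} = t \<inter> {..d} \<Longrightarrow> d \<le> c"
    using node_meet[OF ns nt] by metis
  let ?k = "succ_in s c - succ_in t c"
  have "chart s v = chart t w \<longleftrightarrow>
       snd v = snd w \<and> snd w < c + wait c \<and> fst v = fst w - ?k * bump c (snd w)"
    if vw: "v \<in> strip s" "w \<in> strip t" for v w
  proof -
    define y where "y = snd w"
    have seg: "s \<inter> {..stage s y} = t \<inter> {..stage t y} \<longleftrightarrow> y < c + wait c" if y: "y < ht s" "y < ht t"
    proof
      assume eq: "s \<inter> {..stage s y} = t \<inter> {..stage t y}"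
      have st: "stage s y \<in> s" "stage t y \<in> t" using stage(1)[OF ns y(1)] stage(1)[OF nt y(2)] by simp_all
      have "stage s y = stage t y"
        using eq Sup_Int_atMost[OF st(1)] Sup_Int_atMost[OF st(2)] by metis
      then have le: "stage s y \<le> c" using cmax[of "stage s y"] st eq by metis
      then show "y < c + wait c" using stage(2)[OF ns y(1)] node_gap[OF ns st(1) c(1)] wait_pos[of c]
        by (cases "stage s y = c") auto
    next
      assume y: "y < c + wait c"
      then have "stage s y \<le> c" using stage_le[OF ns c(1)] by simp
      then have "s \<inter> {..stage s y} = (s \<inter> {..c}) \<inter> {..stage s y}"
        "t \<inter> {..stage s y} = (t \<inter> {..c}) \<inter> {..stage s y}" by auto
      then show "s \<inter> {..stage s y} = t \<inter> {..stage t y}"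
        using stage_agree[OF ns nt c y] c(3) by simp
    qed
    have "chart s v = chart t w \<longleftrightarrow> snd v = y \<and> s \<inter> {..stage s y} = t \<inter> {..stage t y} \<and>
        fst v + twist s y = fst w + twist t y"
    proof
      assume eq: "chart s v = chart t w"
      have "s \<inter> {..stage s (snd v)} \<in> T" "t \<inter> {..stage t y} \<in> T"
        using T_segment s t stage(1) ns nt vw unfolding strip_def y_def by auto
      from pt_inj[OF this eq[unfolded chart_def, folded y_def]]
      show "snd v = y \<and> s \<inter> {..stage s y} = t \<inter> {..stage t y} \<and> fst v + twist s y = fst w + twist t y"
        by metis
    next
      assume "snd v = y \<and> s \<inter> {..stage s y} = t \<inter> {..stage t y} \<and> fst v + twist s y = fst w + twist t y"
      then show "chart s v = chart t w" by (metis chart_def y_def)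
    qed
    also have "\<dots> \<longleftrightarrow> snd v = y \<and> y < c + wait c \<and> fst v = fst w - ?k * bump c y"
    proof (cases "snd v = y")
      case True
      then have y: "y < ht s" "y < ht t" using vw by (auto simp: strip_def y_def)
      have "fst v + twist s y = fst w + twist t y \<longleftrightarrow> fst v = fst w - ?k * bump c y" if "y < c + wait c"
        using twist_diff[OF ns nt c that] by auto
      then show ?thesis using seg[OF y] True by blast
    qed simp
    finally show ?thesis by (simp add: y_def)
  qed
  moreover have "?k \<noteq> 0" if y: "c + wait c \<le> y" "y < ht s" "y < ht t" for y
  proof
    assume k: "?k = 0"
    have "c < Sup w" if "node w" "c \<in> w" "y < ht w" for w
      using y(1) that node_le_Sup[OF that(1,2)] unfolding ht_def by (cases "c = Sup w") auto
    then have lt: "c < Sup s" "c < Sup t" using ns nt c(1,2) y(2,3) by simp_all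
    define n where "n = succ_in s c"
    have n': "n = succ_in t c" using k by (simp add: n_def)
    note ss = succ_in[OF ns node_Sup_in[OF ns] lt(1), folded n_def]
    note tt = succ_in[OF nt node_Sup_in[OF nt] lt(2), folded n']
    have "w \<inter> {..n} = insert n (w \<inter> {..c})"
      if "n \<in> w" "c < n" "\<And>x. x \<in> w \<Longrightarrow> c < x \<Longrightarrow> n \<le> x" for w
    proof (rule set_eqI)
      fix x show "x \<in> w \<inter> {..n} \<longleftrightarrow> x \<in> insert n (w \<inter> {..c})"
        using that(1,2) that(3)[of x] by (cases "x \<le> c") auto
    qed
    from this[OF ss] this[OF tt] have "s \<inter> {..n} = t \<inter> {..n}" using c(3) by simp
    then show False using cmax[of n] ss tt by simp
  qed
  ultimately show thesis using that c by blast
qed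

definition carrier_set :: "'p set" where
  "carrier_set = (\<Union>s\<in>T. chart s ` strip s)"

text \<open>The final topology with respect to all charts.\<close>

definition surf :: "'p topology" where
  "surf = topology (\<lambda>W. W \<subseteq> carrier_set \<and> (\<forall>s\<in>T. open {v \<in> strip s. chart s v \<in> W}))"

lemma openin_surf: "openin surf W \<longleftrightarrow> W \<subseteq> carrier_set \<and> (\<forall>s\<in>T. open {v \<in> strip s. chart s v \<in> W})"
proof -
  have "istopology (\<lambda>W. W \<subseteq> carrier_set \<and> (\<forall>s\<in>T. open {v \<in> strip s. chart s v \<in> W}))"
    unfolding istopology_def
  proof (rule conjI; intro allI impI conjI ballI)
    fix U V s
    assume U: "U \<subseteq> carrier_set \<and> (\<forall>s\<in>T. open {v \<in> strip s. chart s v \<in> U})"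
      and V: "V \<subseteq> carrier_set \<and> (\<forall>s\<in>T. open {v \<in> strip s. chart s v \<in> V})"
    show "U \<inter> V \<subseteq> carrier_set" using U by blast
    assume s: "s \<in> T"
    have "{v \<in> strip s. chart s v \<in> U \<inter> V} = {v \<in> strip s. chart s v \<in> U} \<inter> {v \<in> strip s. chart s v \<in> V}"
      by blast
    then show "open {v \<in> strip s. chart s v \<in> U \<inter> V}" using U V s by (simp add: open_Int)
  next
    fix \<K> s
    assume K: "\<forall>K\<in>\<K>. K \<subseteq> carrier_set \<and> (\<forall>s\<in>T. open {v \<in> strip s. chart s v \<in> K})"
    show "\<Union> \<K> \<subseteq> carrier_set" using K by blast
    assume s: "s \<in> T"
    have "{v \<in> strip s. chart s v \<in> \<Union>\<K>} = (\<Union>K\<in>\<K>. {v \<in> strip s. chart s v \<in> K})"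
      by blast
    moreover have "open (\<Union>K\<in>\<K>. {v \<in> strip s. chart s v \<in> K})" using K s by blast
    ultimately show "open {v \<in> strip s. chart s v \<in> \<Union>\<K>}" by simp
  qed
  then show ?thesis unfolding surf_def by (simp add: topology_inverse')
qed

lemma topspace_surf: "topspace surf = carrier_set"
proof -
  have "{v \<in> strip s. chart s v \<in> carrier_set} = strip s" if "s \<in> T" for s
    using that by (auto simp: carrier_set_def)
  then have "openin surf carrier_set" by (simp add: openin_surf open_strip)
  then show ?thesis using openin_surf openin_topspace[of surf] openin_subset by blast
qed

lemma chart_in: "s \<in> T \<Longrightarrow> v \<in> strip s \<Longrightarrow> chart s v \<in> topspace surf"
  unfolding topspace_surf carrier_set_def by blast

lemma openin_chart_image:
  assumes s: "s \<in> T" and V: "V \<subseteq> strip s" "open V"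
  shows "openin surf (chart s ` V)"
  unfolding openin_surf
proof (intro conjI ballI)
  show "chart s ` V \<subseteq> carrier_set" using s V by (auto simp: carrier_set_def)
  fix t assume t: "t \<in> T"
  obtain c k where c: "\<And>v w. v \<in> strip s \<Longrightarrow> w \<in> strip t \<Longrightarrow> chart s v = chart t w \<longleftrightarrow>
       snd v = snd w \<and> snd w < c + wait c \<and> fst v = fst w - k * bump c (snd w)"
    using chart_overlap[OF s t] by metis
  define S :: "(real \<times> real) set" where "S = {w. snd w < ht t \<and> snd w < c + wait c}"
  define g where "g w = (fst w - k * bump c (snd w), snd w)" for w :: "real \<times> real"
  have "{w \<in> strip t. chart t w \<in> chart s ` V} = {w \<in> S. g w \<in> V}"
  proof (rule set_eqI, simp only: mem_Collect_eq, intro iffI conjI)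
    fix w assume w: "w \<in> strip t \<and> chart t w \<in> chart s ` V"
    then obtain v where v: "v \<in> V" "chart s v = chart t w" by auto
    have "v \<in> strip s" using v V by blast
    then have *: "snd v = snd w \<and> snd w < c + wait c \<and> fst v = fst w - k * bump c (snd w)"
      using c v w by blast
    then show "w \<in> S" using w by (simp add: S_def strip_def)
    have "g w = v" using * by (simp add: g_def prod_eq_iff)
    then show "g w \<in> V" using v by simp
  next
    fix w assume w: "w \<in> S \<and> g w \<in> V"
    then show wt: "w \<in> strip t" by (simp add: S_def strip_def)
    have "g w \<in> strip s" using V w by blast
    then have "chart s (g w) = chart t w" using c[OF _ wt] w by (simp add: g_def S_def)
    then show "chart t w \<in> chart s ` V" using w by (metis image_eqI)
  qed
  moreover have "open {w \<in> S. g w \<in> V}"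
  proof -
    have "open S" unfolding S_def by (intro open_Collect_conj open_Collect_less continuous_intros)
    moreover have "continuous_on S g"
      unfolding g_def S_def
      by (intro continuous_intros continuous_on_compose2[OF continuous_on_bump[of c]]) auto
    ultimately have "open (S \<inter> g -` V)" using V(2) continuous_open_preimage by blast
    moreover have "S \<inter> g -` V = {w \<in> S. g w \<in> V}" by blast
    ultimately show ?thesis by simp
  qed
  ultimately show "open {w \<in> strip t. chart t w \<in> chart s ` V}" by simp
qed

lemma inj_on_chart:
  assumes "s \<in> T"
  shows "inj_on (chart s) (strip s)"
proof (rule inj_onI)
  fix v w assume vw: "v \<in> strip s" "w \<in> strip s" "chart s v = chart s w"
  have "s \<inter> {..stage s (snd v)} \<in> T" "s \<inter> {..stage s (snd w)} \<in> T"
    using T_segment stage(1) T_node assms vw unfolding strip_def by auto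
  from pt_inj[OF this vw(3)[unfolded chart_def]] have "snd v = snd w" "fst v = fst w"
    by (metis, metis add_right_cancel)
  then show "v = w" by (simp add: prod_eq_iff)
qed

lemma continuous_map_chart: "s \<in> T \<Longrightarrow> continuous_map (top_of_set (strip s)) surf (chart s)"
  unfolding continuous_map_def
  by (auto simp: chart_in openin_open_eq open_strip openin_surf)

lemma homeomorphic_map_chart:
  assumes s: "s \<in> T"
  shows "homeomorphic_map (top_of_set (strip s)) (subtopology surf (chart s ` strip s)) (chart s)"
proof (rule bijective_open_imp_homeomorphic_map)
  show "continuous_map (top_of_set (strip s)) (subtopology surf (chart s ` strip s)) (chart s)"
    using continuous_map_chart[OF s] by (simp add: continuous_map_in_subtopology)
  show "open_map (top_of_set (strip s)) (subtopology surf (chart s ` strip s)) (chart s)"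
    unfolding open_map_def
  proof (intro allI impI)
    fix V assume "openin (top_of_set (strip s)) V"
    then have "V \<subseteq> strip s" "open V" using openin_open_eq[OF open_strip] by auto
    then show "openin (subtopology surf (chart s ` strip s)) (chart s ` V)"
      using openin_chart_image[OF s] unfolding openin_subtopology by blast
  qed
  show "chart s ` topspace (top_of_set (strip s)) = topspace (subtopology surf (chart s ` strip s))"
    using chart_in[OF s] by auto
  show "inj_on (chart s) (topspace (top_of_set (strip s)))" using inj_on_chart[OF s] by simp
qed

end

context branching_surface
begin

lemma chart_height:
  assumes "s \<in> T" "t \<in> T" "v \<in> strip s" "w \<in> strip t" "chart s v = chart t w"
  shows "snd v = snd w"
  using chart_overlap[OF assms(1,2)] assms(3-5) by metis

lemma openin_heights:
  assumes "open H"
  shows "openin surf (\<Union>s\<in>T. chart s ` (strip s \<inter> {v. snd v \<in> H}))"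
proof (rule openin_Union, clarify)
  fix s assume s: "s \<in> T"
  have "open (snd -` H :: (real \<times> real) set)" by (rule open_vimage_snd[OF assms])
  moreover have "snd -` H = {v :: real \<times> real. snd v \<in> H}" by auto
  ultimately show "openin surf (chart s ` (strip s \<inter> {v. snd v \<in> H}))"
    using openin_chart_image[OF s] open_strip[of s] by (simp add: open_Int)
qed

text \<open>
  Points at different heights are separated by their heights, and points in a common chart by that chart. For
  points that both lie at the same height at or above the separation, small boxes are disjoint: on the overlap
  their fibre coordinates differ by a nonzero multiple of a bump, which is large near the separation.
\<close>

lemma Hausdorff_surf: "Hausdorff_space surf"
  unfolding Hausdorff_space_def
proof (intro allI impI)
  fix p q assume pq: "p \<in> topspace surf \<and> q \<in> topspace surf \<and> p \<noteq> q"
  then obtain s v t w where s: "s \<in> T" "v \<in> strip s" "p = chart s v" and t: "t \<in> T" "w \<in> strip t" "q = chart t w"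
    unfolding topspace_surf carrier_set_def by blast
  show "\<exists>U V. openin surf U \<and> openin surf V \<and> p \<in> U \<and> q \<in> V \<and> disjnt U V"
  proof (cases "snd v = snd w")
    case False
    let ?S = "\<lambda>H. \<Union>s\<in>T. chart s ` (strip s \<inter> {v. snd v \<in> H})"
    obtain H K where HK: "open H" "open K" "snd v \<in> H" "snd w \<in> K" "H \<inter> K = {}"
      using hausdorff[OF False] by metis
    have "disjnt (?S H) (?S K)"
      unfolding disjnt_iff
    proof (intro allI notI, elim conjE UN_E imageE)
      fix x s1 v1 s2 v2
      assume "s1 \<in> T" "x = chart s1 v1" "v1 \<in> strip s1 \<inter> {v. snd v \<in> H}"
        and "s2 \<in> T" "x = chart s2 v2" "v2 \<in> strip s2 \<inter> {v. snd v \<in> K}"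
      then show False using chart_height[of s1 s2 v1 v2] HK(5) by auto
    qed
    moreover have "p \<in> ?S H" "q \<in> ?S K" using s t HK by blast+
    ultimately show ?thesis using openin_heights[OF HK(1)] openin_heights[OF HK(2)] by blast
  next
    case True
    obtain c k where c: "\<And>v w. v \<in> strip s \<Longrightarrow> w \<in> strip t \<Longrightarrow> chart s v = chart t w \<longleftrightarrow>
       snd v = snd w \<and> snd w < c + wait c \<and> fst v = fst w - k * bump c (snd w)"
      and k: "\<And>y. c + wait c \<le> y \<Longrightarrow> y < ht s \<Longrightarrow> y < ht t \<Longrightarrow> k \<noteq> 0"
      by (rule chart_overlap[OF s(1) t(1)]) (rule that; assumption)
    show ?thesis
    proof (cases "snd w < c + wait c")
      case less: True
      define w' where "w' = (fst w - k * bump c (snd w), snd w)"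
      have w': "w' \<in> strip s" using s(2) True by (simp add: w'_def strip_def)
      have q: "chart s w' = q" using c[OF w' t(2)] t(3) less by (simp add: w'_def)
      then have "v \<noteq> w'" using pq s by blast
      then obtain U V where UV: "open U" "open V" "v \<in> U" "w' \<in> V" "U \<inter> V = {}"
        using hausdorff by metis
      have "disjnt (chart s ` (strip s \<inter> U)) (chart s ` (strip s \<inter> V))"
        using UV(5) inj_on_chart[OF s(1)] unfolding disjnt_iff inj_on_def by blast
      moreover have "openin surf (chart s ` (strip s \<inter> U))" "openin surf (chart s ` (strip s \<inter> V))"
        using openin_chart_image[OF s(1)] open_strip UV by (simp_all add: open_Int)
      moreover have "p \<in> chart s ` (strip s \<inter> U)" "q \<in> chart s ` (strip s \<inter> V)"
        using s UV w' q by blast+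
      ultimately show ?thesis by blast
    next
      case False
      have "k \<noteq> 0" using k[of "snd w"] False s t True by (simp add: strip_def)
      obtain \<eta> where \<eta>: "0 < \<eta>"
        "\<And>y. c + wait c - \<eta> < y \<Longrightarrow> y < c + wait c \<Longrightarrow> (\<bar>fst v - fst w\<bar> + 2) / \<bar>k\<bar> < bump c y"
        using bump_blows_up by metis
      define B where "B u = {x :: real \<times> real. \<bar>fst x - fst u\<bar> < 1 \<and> c + wait c - \<eta> < snd x}" for u :: "real \<times> real"
      have B: "open (B u)" for u
        unfolding B_def by (intro open_Collect_conj open_Collect_less continuous_intros)
      have "disjnt (chart s ` (strip s \<inter> B v)) (chart t ` (strip t \<inter> B w))"
        unfolding disjnt_iff
      proof (intro allI notI, elim conjE imageE)
        fix x v1 w1 assume x: "x = chart s v1" "x = chart t w1" "v1 \<in> strip s \<inter> B v" "w1 \<in> strip t \<inter> B w"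
        then have *: "snd w1 < c + wait c" "fst v1 = fst w1 - k * bump c (snd w1)"
          using c[of v1 w1] by auto
        have "c + wait c - \<eta> < snd w1" using x(4) by (simp add: B_def)
        then have "\<bar>fst v - fst w\<bar> + 2 < \<bar>k\<bar> * bump c (snd w1)"
          using \<eta>(2)[OF _ *(1)] \<open>k \<noteq> 0\<close> by (simp add: field_simps)
        also have "\<dots> = \<bar>k * bump c (snd w1)\<bar>" by (simp add: abs_mult bump_nonneg)
        also have "\<dots> = \<bar>fst v1 - fst w1\<bar>" using *(2) by simp
        also have "\<dots> \<le> \<bar>fst v - fst w\<bar> + \<bar>fst v1 - fst v\<bar> + \<bar>fst w1 - fst w\<bar>" by linarith
        finally show False using x(3,4) by (simp add: B_def)
      qed
      moreover have "openin surf (chart s ` (strip s \<inter> B v))" "openin surf (chart t ` (strip t \<inter> B w))"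
        using openin_chart_image s t open_strip B by (simp_all add: open_Int)
      moreover have "p \<in> chart s ` (strip s \<inter> B v)" "q \<in> chart t ` (strip t \<inter> B w)"
        using s t False \<eta>(1) True by (auto simp: B_def)
      ultimately show ?thesis by blast
    qed
  qed
qed

text \<open>
  Both homotopies preserve the domains of all charts. So they can be given, and their continuity can be
  proved, in each half plane separately.
\<close>

lemma continuous_map_by_charts:
  assumes cont: "\<And>s. s \<in> T \<Longrightarrow> continuous_on ({0..1} \<times> {v \<in> strip s. chart s v \<in> Y}) (G s)"
    and into: "\<And>s u v. s \<in> T \<Longrightarrow> u \<in> {0..1} \<Longrightarrow> v \<in> strip s \<Longrightarrow> chart s v \<in> Y \<Longrightarrow> G s (u, v) \<in> strip s"
    and H: "\<And>s u v. s \<in> T \<Longrightarrow> u \<in> {0..1} \<Longrightarrow> v \<in> strip s \<Longrightarrow> chart s v \<in> Y \<Longrightarrow> H (u, chart s v) = chart s (G s (u, v))"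
  shows "continuous_map (prod_topology (top_of_set {0..1::real}) (subtopology surf Y)) surf H"
proof (rule pasting_lemma[where I=T and T="\<lambda>s. {0..1} \<times> (chart s ` strip s \<inter> Y)" and f="\<lambda>_. H"])
  fix s assume s: "s \<in> T"
  let ?Z = "prod_topology (top_of_set {0..1::real}) (subtopology surf Y)"
  have Us: "openin surf (chart s ` strip s)" using openin_chart_image[OF s _ open_strip] by blast
  show "openin ?Z ({0..1} \<times> (chart s ` strip s \<inter> Y))"
    unfolding openin_prod_Times_iff using openin_subtopology_Int[OF Us, of Y] by auto
  show "continuous_map (subtopology ?Z ({0..1} \<times> (chart s ` strip s \<inter> Y))) surf H"
  proof -
    let ?D = "{v \<in> strip s. chart s v \<in> Y}"
    obtain g where g: "homeomorphic_maps (top_of_set (strip s)) (subtopology surf (chart s ` strip s)) (chart s) g"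
      using homeomorphic_map_chart[OF s] unfolding homeomorphic_map_maps by blast
    then have gc: "continuous_map (subtopology surf (chart s ` strip s)) (top_of_set (strip s)) g"
      and gv: "\<And>v. v \<in> strip s \<Longrightarrow> g (chart s v) = v"
      unfolding homeomorphic_maps_def by auto
    have sub: "subtopology ?Z ({0..1} \<times> (chart s ` strip s \<inter> Y))
       = prod_topology (top_of_set {0..1}) (subtopology (subtopology surf (chart s ` strip s)) Y)"
      by (simp add: subtopology_Times subtopology_subtopology Int_left_commute Int_commute)
    have "continuous_map (subtopology (subtopology surf (chart s ` strip s)) Y) (top_of_set ?D) g"
      using continuous_map_from_subtopology[OF gc, of Y] gv
      by (auto simp: continuous_map_in_subtopology)
    then have "continuous_map (subtopology ?Z ({0..1} \<times> (chart s ` strip s \<inter> Y))) (prod_topology (top_of_set {0..1}) (top_of_set ?D)) (\<lambda>x. (fst x, g (snd x)))"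
      unfolding sub continuous_map_pairwise o_def
      by (simp add: continuous_map_fst continuous_map_compose[OF continuous_map_snd, unfolded o_def])
    moreover have "continuous_map (prod_topology (top_of_set {0..1}) (top_of_set ?D)) (top_of_set (strip s)) (G s)"
      using cont[OF s] into[OF s] by auto
    ultimately have "continuous_map (subtopology ?Z ({0..1} \<times> (chart s ` strip s \<inter> Y))) surf (chart s \<circ> (G s \<circ> (\<lambda>x. (fst x, g (snd x)))))"
      using continuous_map_chart[OF s] by (intro continuous_map_compose)
    then show ?thesis
    proof (rule continuous_map_eq)
      fix x assume "x \<in> topspace (subtopology ?Z ({0..1} \<times> (chart s ` strip s \<inter> Y)))"
      then obtain u v where x: "x = (u, chart s v)" "u \<in> {0..1}" "v \<in> strip s" "chart s v \<in> Y" by auto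
      show "(chart s \<circ> (G s \<circ> (\<lambda>x. (fst x, g (snd x))))) x = H x"
        using H[OF s x(2-4)] gv[OF x(3)] by (simp add: x(1))
    qed
  qed
next
  fix x assume "x \<in> topspace (prod_topology (top_of_set {0..1::real}) (subtopology surf Y))"
  then show "\<exists>j. j \<in> T \<and> x \<in> {0..1} \<times> (chart j ` strip j \<inter> Y) \<and> H x = H x"
    unfolding topspace_prod_topology topspace_subtopology topspace_surf carrier_set_def by auto
qed simp

end

text \<open>The half plane is opened up to the plane by a logarithm in the height.\<close>

lemma strip_homeomorphic_Euclidean_2:
  "top_of_set {v :: real \<times> real. snd v < h} homeomorphic_space Euclidean_space 2"
proof -
  let ?f = "\<lambda>v (i::nat). if i = 0 then fst v else if i = 1 then - ln (h - snd v) else (0::real)"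
  let ?g = "\<lambda>x :: nat \<Rightarrow> real. (x 0, h - exp (- x 1))"
  have "continuous_map (top_of_set {v :: real \<times> real. snd v < h}) (Euclidean_space 2) ?f"
  proof -
    have "?f v = (\<lambda>i. if i < 2 then (if i = 0 then fst v else - ln (h - snd v)) else 0)" for v :: "real \<times> real"
      by (auto simp: fun_eq_iff)
    moreover have "continuous_map (top_of_set {v :: real \<times> real. snd v < h}) (Euclidean_space 2)
       (\<lambda>v i. if i < 2 then (if i = 0 then fst v else - ln (h - snd v)) else 0)"
      unfolding continuous_map_componentwise_Euclidean_space
    proof (intro allI impI)
      fix i :: nat
      show "continuous_map (top_of_set {v. snd v < h}) euclideanreal (\<lambda>v. if i = 0 then fst v else - ln (h - snd v))"
        by (cases "i = 0") (auto intro!: continuous_intros)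
    qed
    ultimately show ?thesis by simp
  qed
  moreover have "continuous_map (Euclidean_space 2) (top_of_set {v :: real \<times> real. snd v < h}) ?g"
  proof -
    have p: "continuous_map (Euclidean_space 2) euclideanreal (\<lambda>x. x i)" for i :: nat
      unfolding Euclidean_space_def
      by (intro continuous_map_from_subtopology continuous_map_product_projection) simp
    have "continuous_map euclideanreal euclideanreal (\<lambda>y. h - exp (- y))"
      by (simp add: continuous_intros)
    from continuous_map_compose[OF p[of 1] this] p[of 0]
    have "continuous_map (Euclidean_space 2) (prod_topology euclideanreal euclideanreal) ?g"
      unfolding continuous_map_pairwise o_def by simp
    then show ?thesis by (simp add: continuous_map_in_subtopology)
  qed
  ultimately have "homeomorphic_maps (top_of_set {v :: real \<times> real. snd v < h}) (Euclidean_space 2) ?f ?g"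
    unfolding homeomorphic_maps_def
    by (auto simp: topspace_Euclidean_space fun_eq_iff)
  then show ?thesis unfolding homeomorphic_space_def by blast
qed

context branching_surface
begin

lemma surf_locally_Euclidean:
  assumes "p \<in> topspace surf"
  shows "\<exists>U N. openin surf U \<and> p \<in> U \<and> U \<subseteq> N \<and> N \<subseteq> topspace surf \<and>
     subtopology surf N homeomorphic_space Euclidean_space 2"
proof -
  obtain s v where s: "s \<in> T" "v \<in> strip s" "p = chart s v"
    using assms unfolding topspace_surf carrier_set_def by blast
  have "top_of_set (strip s) homeomorphic_space subtopology surf (chart s ` strip s)"
    using homeomorphic_map_chart[OF s(1)] homeomorphic_map_imp_homeomorphic_space by blast
  then have "subtopology surf (chart s ` strip s) homeomorphic_space Euclidean_space 2"
    using strip_homeomorphic_Euclidean_2[of "ht s"] unfolding strip_def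
    by (meson homeomorphic_space_sym homeomorphic_space_trans)
  moreover have "openin surf (chart s ` strip s)"
    using openin_chart_image[OF s(1) _ open_strip] by blast
  ultimately show ?thesis using s openin_subset by blast
qed

end

section \<open>Moving down along rays\<close>

text \<open>
  Within the stage of \<open>a\<close>, the phase \<open>z\<close> is the position between \<open>a\<close> and \<open>a + wait a\<close>, scaled to the unit
  interval, and \<open>bump a = z / (1 - z)\<close>.
\<close>

definition phase :: "real \<Rightarrow> real \<Rightarrow> real" where
  "phase a y = max 0 (min 1 ((y - a) / wait a))"

text \<open>
  The final factor of the first homotopy. With \<open>b = bump a y\<close> it is \<open>wait a * sqrt b / (1 + b)\<close>. It tends to
  zero at both ends of the stage and is at most \<open>wait a\<close>, so fibre coordinates tend to zero wherever a
  bump vanishes or a stage ends; yet it decreases so slowly that \<open>pinch a y * bump a y\<close> still tends to infinity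
  at the upper end, so that heights near that end hardly change.
\<close>

definition pinch :: "real \<Rightarrow> real \<Rightarrow> real" where
  "pinch a y = wait a * sqrt (phase a y * (1 - phase a y))"

text \<open>The linear path of factors from \<open>1\<close> to the pinching factor.\<close>

definition ray :: "real \<Rightarrow> real \<Rightarrow> real \<Rightarrow> real" where
  "ray a u y = 1 - u + u * pinch a y"

text \<open>
  The descent by which \<open>bump a\<close> is multiplied by \<open>k = ray a u y\<close>: the phase \<open>z\<close> has to become
  \<open>k * z / (1 - z + k * z)\<close>.
\<close>

definition sink :: "real \<Rightarrow> real \<Rightarrow> real \<Rightarrow> real" where
  "sink a u y = wait a * phase a y * (1 - phase a y) * (1 - ray a u y) / (1 - phase a y + ray a u y * phase a y)"

text \<open>
  A bound on the descent for all times \<open>u\<close>. It arises from \<open>sink\<close> by replacing \<open>ray\<close> with its lower bound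
  \<open>pinch\<close> in the denominator and cancelling \<open>sqrt (1 - z)\<close>, which makes it continuous at \<open>z = 1\<close>.
\<close>

definition sink_bound :: "real \<Rightarrow> real \<Rightarrow> real" where
  "sink_bound a y = wait a * (phase a y * sqrt (1 - phase a y) /
     (sqrt (1 - phase a y) + wait a * phase a y * sqrt (phase a y)))"

lemma phase_range: "0 \<le> phase a y" "phase a y \<le> 1"
  by (auto simp: phase_def)

lemma phase_below: "y \<le> a \<Longrightarrow> phase a y = 0"
  using wait_pos[of a] divide_nonpos_pos[of "y - a" "wait a"] by (simp add: phase_def)

lemma phase_above: "a + wait a \<le> y \<Longrightarrow> phase a y = 1"
  using wait_pos[of a] by (simp add: phase_def field_simps)

lemma phase_within: "a \<le> y \<Longrightarrow> y \<le> a + wait a \<Longrightarrow> phase a y = (y - a) / wait a"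
  using wait_pos[of a] by (simp add: phase_def field_simps)

lemma phase_less_1: "y < a + wait a \<Longrightarrow> phase a y < 1"
  using wait_pos[of a] by (simp add: phase_def field_simps max_def)

lemma phase_pos: "a < y \<Longrightarrow> 0 < phase a y"
  using wait_pos[of a] by (simp add: phase_def field_simps)

lemma isCont_phase: "isCont (phase a) y"
  unfolding phase_def using wait_pos[of a] by (intro continuous_intros) auto

lemma pinch_nonneg: "0 \<le> pinch a y"
  using phase_range[of a y] wait_pos[of a] by (simp add: pinch_def)

lemma pinch_le_wait: "pinch a y \<le> wait a"
proof -
  have "phase a y * (1 - phase a y) \<le> 1 * 1" using phase_range[of a y] by (intro mult_mono) auto
  then have "sqrt (phase a y * (1 - phase a y)) \<le> 1" by simp
  then show ?thesis using wait_pos[of a] unfolding pinch_def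
    by (metis mult.right_neutral mult_le_cancel_left_pos)
qed

lemma isCont_pinch: "isCont (pinch a) y"
  unfolding pinch_def by (intro continuous_intros isCont_phase)

lemma pinch_eq_0: "y \<le> a \<or> a + wait a \<le> y \<Longrightarrow> pinch a y = 0"
  using phase_below[of y a] phase_above[of a y] by (auto simp: pinch_def)

lemma pinch_pos: "a < y \<Longrightarrow> y < a + wait a \<Longrightarrow> 0 < pinch a y"
  using phase_pos[of a y] phase_less_1[of y a] wait_pos[of a] by (simp add: pinch_def)

lemma ray_bounds:
  assumes "u \<in> {0..1}"
  shows "pinch a y \<le> ray a u y" "ray a u y \<le> 1" "0 \<le> ray a u y"
proof -
  have p: "0 \<le> pinch a y" "pinch a y \<le> 1"
    using pinch_nonneg pinch_le_wait[of a y] wait_le_1[of a] by auto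
  have "0 \<le> (1 - u) * (1 - pinch a y)" "0 \<le> u * (1 - pinch a y)" using assms p by auto
  then show "pinch a y \<le> ray a u y" "ray a u y \<le> 1" by (auto simp: ray_def algebra_simps)
  then show "0 \<le> ray a u y" using p by linarith
qed

lemma sink_denominator_pos:
  assumes "u \<in> {0..1}" "y < a + wait a"
  shows "0 < 1 - phase a y + ray a u y * phase a y"
  using phase_less_1[OF assms(2)] phase_range(1)[of a y] ray_bounds(3)[OF assms(1), of a y]
  by (simp add: add_pos_nonneg)

lemma sink_below: "y \<le> a \<Longrightarrow> sink a u y = 0"
  by (simp add: sink_def phase_below)

lemma sink_phase:
  assumes u: "u \<in> {0..1}" and y: "a \<le> y" "y < a + wait a"
  shows "y - sink a u y = a + wait a * (ray a u y * phase a y / (1 - phase a y + ray a u y * phase a y))"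
proof -
  define z k d where "z = phase a y" "k = ray a u y" "d = 1 - z + k * z"
  have d: "d \<noteq> 0" using sink_denominator_pos[OF u y(2)] by (simp add: z_k_d_def)
  have "y = a + wait a * z" using phase_within[of a y] y wait_pos[of a] by (simp add: z_k_d_def)
  moreover have "sink a u y = wait a * z * (1 - z) * (1 - k) / d" by (simp add: sink_def z_k_d_def)
  moreover have "z * d - z * (1 - z) * (1 - k) = k * z" by (simp add: z_k_d_def(3) algebra_simps)
  then have "z - z * (1 - z) * (1 - k) / d = k * z / d" using d by (simp add: field_simps)
  ultimately have "y - sink a u y = a + wait a * (k * z / d)" by (simp add: algebra_simps flip: \<open>z - z * (1 - z) * (1 - k) / d = k * z / d\<close>)
  then show ?thesis by (simp add: z_k_d_def)
qed

lemma sink_range: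
  assumes u: "u \<in> {0..1}" and y: "a \<le> y" "y < a + wait a"
  shows "a \<le> y - sink a u y" "y - sink a u y < a + wait a"
proof -
  define z k where "z = phase a y" "k = ray a u y"
  have z: "0 \<le> z" "z < 1" "0 \<le> k" using phase_range phase_less_1[OF y(2)] ray_bounds(3)[OF u] by (auto simp: z_k_def)
  have d: "0 < 1 - z + k * z" using sink_denominator_pos[OF u y(2)] by (simp add: z_k_def)
  define p where "p = k * z / (1 - z + k * z)"
  have "0 \<le> p" "p < 1" using z d by (auto simp: p_def)
  moreover have "y - sink a u y = a + wait a * p" using sink_phase[OF assms] by (simp add: p_def z_k_def)
  ultimately show "a \<le> y - sink a u y" "y - sink a u y < a + wait a"
    using wait_pos[of a] by simp_all
qed

lemma bump_sink:
  assumes u: "u \<in> {0..1}" and y: "y < a + wait a"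
  shows "bump a (y - sink a u y) = ray a u y * bump a y"
proof (cases "a \<le> y")
  case True
  define z k where "z = phase a y" "k = ray a u y"
  have z: "z < 1" using phase_less_1[OF y] by (simp add: z_k_def)
  have d: "0 < 1 - z + k * z" using sink_denominator_pos[OF u y] by (simp add: z_k_def)
  have y': "y = a + wait a * z" using phase_within[of a y] y True wait_pos[of a] by (simp add: z_k_def)
  have "bump a y = (wait a * z) / (wait a * (1 - z))" using bump_eq[OF True y] y' by (simp add: algebra_simps)
  then have b: "bump a y = z / (1 - z)" using wait_pos[of a] by simp
  define z' where "z' = k * z / (1 - z + k * z)"
  have y2: "y - sink a u y = a + wait a * z'" using sink_phase[OF u True y] by (simp add: z'_def z_k_def)
  have "bump a (y - sink a u y) = (wait a * z') / (wait a * (1 - z'))"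
    using bump_eq[OF sink_range[OF u True y]] by (simp only: y2) (simp add: algebra_simps)
  also have "\<dots> = z' / (1 - z')" using wait_pos[of a] by simp
  also have "1 - z' = (1 - z) / (1 - z + k * z)" using d by (simp add: z'_def field_simps)
  also have "z' / ((1 - z) / (1 - z + k * z)) = k * (z / (1 - z))" using d z by (simp add: z'_def)
  finally show ?thesis using b by (simp add: z_k_def)
qed (simp add: sink_below bump_eq_0)

lemma sink_bound_denominator_pos: "0 < sqrt (1 - phase a y) + wait a * phase a y * sqrt (phase a y)"
proof (cases "phase a y = 1")
  case False
  then have "0 < sqrt (1 - phase a y)" using phase_range[of a y] by simp
  then show ?thesis using phase_range[of a y] wait_pos[of a] by (simp add: add_pos_nonneg)
qed (use wait_pos[of a] in simp)

lemma isCont_sink_bound: "isCont (sink_bound a) y"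
  unfolding sink_bound_def using sink_bound_denominator_pos[of a y]
  by (intro continuous_intros isCont_phase) auto

lemma sink_bound_eq_0: "y \<le> a \<or> a + wait a \<le> y \<Longrightarrow> sink_bound a y = 0"
  using phase_below[of y a] phase_above[of a y] by (auto simp: sink_bound_def)

lemma sink_bound_le_wait: "sink_bound a y \<le> wait a"
proof -
  let ?z = "phase a y"
  have "?z * sqrt (1 - ?z) \<le> 1 * sqrt (1 - ?z)"
    using phase_range[of a y] by (intro mult_right_mono) auto
  also have "\<dots> \<le> sqrt (1 - ?z) + wait a * ?z * sqrt ?z"
    using phase_range[of a y] wait_pos[of a] by simp
  finally have "?z * sqrt (1 - ?z) / (sqrt (1 - ?z) + wait a * ?z * sqrt ?z) \<le> 1"
    using sink_bound_denominator_pos[of a y] by simp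
  then show ?thesis using wait_pos[of a] unfolding sink_bound_def
    by (metis mult.right_neutral mult_le_cancel_left_pos)
qed

lemma sink_le_bound:
  assumes u: "u \<in> {0..1}" and y: "y < a + wait a"
  shows "\<bar>sink a u y\<bar> \<le> sink_bound a y"
proof -
  define z k w q where "z = phase a y" "k = ray a u y" "w = wait a" "q = sqrt (1 - z)"
  note df = this
  have z: "0 \<le> z" "z < 1" using phase_range phase_less_1[OF y] by (auto simp: df)
  have k: "w * sqrt (z * (1 - z)) \<le> k" "k \<le> 1" "0 \<le> k"
    using ray_bounds[OF u, of a y] by (auto simp: df pinch_def)
  have w: "0 < w" using wait_pos by (simp add: df)
  have q: "0 < q" "q * q = 1 - z" using z by (auto simp: df(4))
  have "z * (1 - z) * (1 - k) / (1 - z + k * z) \<le> z * (1 - z) / (1 - z + w * sqrt (z * (1 - z)) * z)"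
  proof (rule frac_le)
    show "z * (1 - z) * (1 - k) \<le> z * (1 - z)" using z k by (simp add: mult_left_le)
    show "0 < 1 - z + w * sqrt (z * (1 - z)) * z" using z w by (simp add: add_pos_nonneg)
    show "1 - z + w * sqrt (z * (1 - z)) * z \<le> 1 - z + k * z" using k z by (simp add: mult_right_mono)
  qed (use z in simp)
  also have "1 - z + w * sqrt (z * (1 - z)) * z = q * (q + w * z * sqrt z)"
  proof -
    have "sqrt (z * (1 - z)) = q * sqrt z" by (simp add: real_sqrt_mult df(4))
    then show ?thesis using q(2) by (simp add: algebra_simps)
  qed
  also have "z * (1 - z) / (q * (q + w * z * sqrt z)) = z * q / (q + w * z * sqrt z)"
    using q by (simp flip: q(2))
  finally have "w * (z * (1 - z) * (1 - k) / (1 - z + k * z)) \<le> w * (z * q / (q + w * z * sqrt z))"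
    using w by (intro mult_left_mono) auto
  moreover have eq: "sink a u y = w * (z * (1 - z) * (1 - k) / (1 - z + k * z))" by (simp add: sink_def df)
  moreover have "0 \<le> sink a u y" unfolding eq using w z k by simp
  moreover have "sink_bound a y = w * (z * q / (q + w * z * sqrt z))" by (simp add: sink_bound_def df)
  ultimately show ?thesis by linarith
qed

lemma stage_within:
  assumes "node s" "a \<in> s" "a \<le> y" "y < a + wait a"
  shows "stage s y = a"
proof (rule stage_eqI[OF assms(1,2,4)])
  fix b assume "b \<in> s" "b < a"
  then show "b + wait b \<le> y" using node_gap[OF assms(1) _ assms(2)] assms(3) by fastforce
qed

text \<open>
  A function given by a different formula in each stage is continuous if the formulas are dominated by
  functions which vanish outside the stage and are at most \<open>wait a\<close>. Only finitely many stages have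
  \<open>wait a \<ge> \<epsilon>\<close>, and near a height in the interior of no stage each of their dominating functions is small.
\<close>

lemma continuous_on_stagewise:
  fixes f :: "real \<Rightarrow> real \<Rightarrow> real \<Rightarrow> real"
  assumes s: "node s"
    and f: "\<And>a. a \<in> s \<Longrightarrow> continuous_on (I \<times> {a<..<a + wait a}) (\<lambda>x. f a (fst x) (snd x))"
    and fg: "\<And>a u y. a \<in> s \<Longrightarrow> u \<in> I \<Longrightarrow> y < a + wait a \<Longrightarrow> \<bar>f a u y\<bar> \<le> g a y"
    and g: "\<And>a y. g a y \<le> wait a" "\<And>a y. isCont (g a) y"
       "\<And>a y. y \<le> a \<or> a + wait a \<le> y \<Longrightarrow> g a y = 0"
  shows "continuous_on (I \<times> {..<ht s}) (\<lambda>x. f (stage s (snd x)) (fst x) (snd x))"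
  unfolding continuous_on_def
proof
  let ?F = "\<lambda>x. f (stage s (snd x)) (fst x) (snd x)"
  fix x0 assume x0: "x0 \<in> I \<times> {..<ht s}"
  define a0 where "a0 = stage s (snd x0)"
  have a0: "a0 \<in> s" "snd x0 < a0 + wait a0" using stage[OF s] x0 by (auto simp: a0_def)
  show "(?F \<longlongrightarrow> ?F x0) (at x0 within I \<times> {..<ht s})"
  proof (cases "a0 < snd x0")
    case True
    let ?U = "UNIV \<times> {a0<..<a0 + wait a0}"
    have le: "a0 + wait a0 \<le> ht s" by (rule wait_le_ht[OF s a0(1)])
    have eq: "at x0 within I \<times> {..<ht s} = at x0 within I \<times> {a0<..<a0 + wait a0}"
    proof (rule at_within_nhd[where S="?U"])
      show "x0 \<in> ?U" using True a0 by (auto simp: mem_Times_iff)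
      show "open ?U" by (intro open_Times) auto
      show "I \<times> {..<ht s} \<inter> ?U - {x0} = I \<times> {a0<..<a0 + wait a0} \<inter> ?U - {x0}" using le by auto
    qed
    have "continuous_on (I \<times> {a0<..<a0 + wait a0}) ?F"
      using f[OF a0(1)] by (rule continuous_on_eq) (use stage_within[OF s a0(1)] in auto)
    moreover have "x0 \<in> I \<times> {a0<..<a0 + wait a0}" using x0 True a0 by (auto simp: mem_Times_iff)
    ultimately show ?thesis unfolding eq continuous_on_def by blast
  next
    case False
    have F0: "?F x0 = 0" using fg[OF a0(1), of "fst x0" "snd x0"] g(3)[of "snd x0" a0] a0 x0 False by (auto simp: a0_def)
    have out: "snd x0 \<le> a \<or> a + wait a \<le> snd x0" if "a \<in> s" for a
      using stage_within[OF s that, of "snd x0"] False by (force simp: a0_def)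
    show ?thesis unfolding F0
    proof (rule tendstoI)
      fix \<epsilon> :: real assume \<epsilon>: "0 < \<epsilon>"
      define B where "B = {a \<in> s. \<epsilon> \<le> wait a}"
      have "finite B"
        by (rule finite_subset[OF _ finite_large_wait[OF \<epsilon>]]) (use s in \<open>auto simp: B_def node_def\<close>)
      moreover have "\<forall>\<^sub>F x in at x0 within I \<times> {..<ht s}. g a (snd x) < \<epsilon>" if "a \<in> B" for a
      proof -
        have "((\<lambda>x. g a (snd x)) \<longlongrightarrow> g a (snd x0)) (at x0 within I \<times> {..<ht s})"
          by (rule isCont_tendsto_compose[OF g(2)]) (intro tendsto_intros)
        moreover have "g a (snd x0) = 0" using g(3) out that by (auto simp: B_def)
        ultimately show ?thesis using order_tendstoD(2) \<epsilon> by fastforce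
      qed
      ultimately have "\<forall>\<^sub>F x in at x0 within I \<times> {..<ht s}. \<forall>a\<in>B. g a (snd x) < \<epsilon>"
        by (simp add: eventually_ball_finite_distrib)
      then show "\<forall>\<^sub>F x in at x0 within I \<times> {..<ht s}. dist (?F x) 0 < \<epsilon>"
      proof (rule eventually_elim2)
        show "\<forall>\<^sub>F x in at x0 within I \<times> {..<ht s}. x \<in> I \<times> {..<ht s}"
          by (simp add: eventually_at_filter)
        fix x assume x: "\<forall>a\<in>B. g a (snd x) < \<epsilon>" "x \<in> I \<times> {..<ht s}"
        define a where "a = stage s (snd x)"
        have a: "a \<in> s" "snd x < a + wait a" using stage[OF s] x(2) by (auto simp: a_def)
        have "g a (snd x) < \<epsilon>" using x(1) a(1) g(1)[of a "snd x"] by (cases "a \<in> B") (auto simp: B_def)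
        moreover have "\<bar>?F x\<bar> \<le> g a (snd x)" using fg[OF a(1) _ a(2), of "fst x"] x(2) by (auto simp: a_def)
        ultimately show "dist (?F x) 0 < \<epsilon>" by simp
      qed
    qed
  qed
qed

section \<open>Contractibility\<close>

lemma bump_le_own_stage:
  assumes s: "node s" and y: "y < ht s" and u: "u \<in> {0..1}"
  defines "a \<equiv> stage s y"
  shows "(1 - u) * y < a + wait a" "bump a ((1 - u) * y) \<le> bump a y" "bump a ((1 - u) * y) = 0 \<or> 0 < bump a y"
proof -
  have a: "a \<in> s" "y < a + wait a" "0 \<le> a" using stage[OF s y] s by (auto simp: a_def node_def)
  have le: "(1 - u) * y \<le> max 0 y" using u by (cases "0 \<le> y") (auto simp: mult_left_le_one_le mult_nonneg_nonpos)
  then show lt: "(1 - u) * y < a + wait a" using a wait_pos[of a] by auto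
  show le_bump: "bump a ((1 - u) * y) \<le> bump a y"
  proof (cases "(1 - u) * y \<le> a")
    case True
    then show ?thesis using bump_eq_0 bump_nonneg by simp
  next
    case False
    then have "(1 - u) * y \<le> y" "a < (1 - u) * y" using le a by auto
    then show ?thesis using bump_eq[of a y] bump_eq[of a "(1 - u) * y"] lt a
      by (auto intro!: frac_le)
  qed
  then show "bump a ((1 - u) * y) = 0 \<or> 0 < bump a y" using bump_nonneg[of a "(1 - u) * y"] by linarith
qed

context branching_surface
begin

text \<open>
  A formula in the stored coordinates of a point defines a map on the surface; its expression in a chart is then
  computed from the twist.
\<close>

definition point_map :: "(real \<Rightarrow> real set \<Rightarrow> real \<Rightarrow> real \<Rightarrow> 'p) \<Rightarrow> real \<times> 'p \<Rightarrow> 'p" where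
  "point_map F x = (THE q. \<exists>C\<in>T. \<exists>y \<rho>. snd x = pt C y \<rho> \<and> q = F (fst x) C y \<rho>)"

lemma segment_in_T: "s \<in> T \<Longrightarrow> v \<in> strip s \<Longrightarrow> s \<inter> {..stage s (snd v)} \<in> T"
  using T_segment stage(1) T_node unfolding strip_def by auto

lemma point_map_chart:
  assumes "s \<in> T" "v \<in> strip s"
  shows "point_map F (u, chart s v) = F u (s \<inter> {..stage s (snd v)}) (snd v) (fst v + twist s (snd v))"
  unfolding point_map_def chart_def fst_conv snd_conv
proof (rule the_equality)
  show "\<exists>C\<in>T. \<exists>y \<rho>. pt (s \<inter> {..stage s (snd v)}) (snd v) (fst v + twist s (snd v)) = pt C y \<rho> \<and>
     F u (s \<inter> {..stage s (snd v)}) (snd v) (fst v + twist s (snd v)) = F u C y \<rho>"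
    using segment_in_T[OF assms] by blast
next
  fix q assume "\<exists>C\<in>T. \<exists>y \<rho>. pt (s \<inter> {..stage s (snd v)}) (snd v) (fst v + twist s (snd v)) = pt C y \<rho> \<and> q = F u C y \<rho>"
  then obtain C y \<rho> where C: "C \<in> T" "pt (s \<inter> {..stage s (snd v)}) (snd v) (fst v + twist s (snd v)) = pt C y \<rho>"
     "q = F u C y \<rho>" by blast
  from pt_inj[OF segment_in_T[OF assms] C(1,2)] C(3)
  show "q = F u (s \<inter> {..stage s (snd v)}) (snd v) (fst v + twist s (snd v))" by metis
qed

lemma chart_eqD:
  assumes "s \<in> T" "t \<in> T" "v \<in> strip s" "w \<in> strip t" "chart s v = chart t w"
  shows "snd v = snd w" "stage s (snd v) = stage t (snd w)" "fst v + twist s (snd v) = fst w + twist t (snd w)"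
proof -
  from pt_inj[OF segment_in_T[OF assms(1,3)] segment_in_T[OF assms(2,4)] assms(5)[unfolded chart_def]]
  have eq: "s \<inter> {..stage s (snd v)} = t \<inter> {..stage t (snd w)}"
    and y: "snd v = snd w" and r: "fst v + twist s (snd v) = fst w + twist t (snd w)" by blast+
  show "snd v = snd w" "fst v + twist s (snd v) = fst w + twist t (snd w)" by (fact y r)+
  have "stage s (snd v) \<in> s" "stage t (snd w) \<in> t" using stage(1) T_node assms by (auto simp: strip_def)
  from this[THEN Sup_Int_atMost] show "stage s (snd v) = stage t (snd w)" unfolding eq by simp
qed

text \<open>
  In the stage of \<open>a\<close> the stored fibre coordinate is the coordinate in the chart of the segment up to \<open>a\<close>.
\<close>

lemma chart_segment:
  assumes s: "s \<in> T" and a: "a \<in> s" and y: "y < a + wait a"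
  shows "chart s (r, y) = chart (s \<inter> {..a}) (r + succ_in s a * bump a y, y)"
proof -
  define C where "C = s \<inter> {..a}"
  have ns: "node s" and nC: "node C" using T_node s T_segment[OF s a] by (auto simp: C_def)
  have aC: "a \<in> C" "s \<inter> {..a} = C \<inter> {..a}" using a by (auto simp: C_def)
  have st: "stage C y = stage s y" using stage_agree[OF ns nC a aC y] .
  have le: "stage s y \<le> a" using stage_le[OF ns a y] .
  have "succ_in C a = 0" by (auto simp: succ_in_def C_def)
  then have "twist s y = twist C y + succ_in s a * bump a y"
    using twist_diff[OF ns nC a aC y] by simp
  moreover have "s \<inter> {..stage s y} = C \<inter> {..stage C y}" using le unfolding st by (auto simp: C_def)
  ultimately show ?thesis unfolding chart_def C_def[symmetric] by (simp add: add_ac)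
qed

text \<open>
  The first homotopy, in charts and on the surface. The formula for \<open>descent\<close> is the same for all nodes
  because both summands of a stored fibre coordinate, \<open>r\<close> and a multiple of the bump, are multiplied by \<open>ray\<close>.
\<close>

definition descent :: "real set \<Rightarrow> real \<times> real \<times> real \<Rightarrow> real \<times> real" where
  "descent s x = (let u = fst x; r = fst (snd x); y = snd (snd x); a = stage s y
     in (ray a u y * r, y - sink a u y))"

definition squeeze :: "real \<times> 'p \<Rightarrow> 'p" where
  "squeeze = point_map (\<lambda>u C y \<rho>. pt C (y - sink (Sup C) u y) (ray (Sup C) u y * \<rho>))"

lemma stage_sink:
  assumes s: "node s" and y: "y < ht s" and u: "u \<in> {0..1}"
  shows "stage s (y - sink (stage s y) u y) = stage s y" "y - sink (stage s y) u y < ht s"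
proof -
  define a where "a = stage s y"
  have a: "a \<in> s" "y < a + wait a" using stage[OF s y] by (auto simp: a_def)
  have le: "a + wait a \<le> ht s" by (rule wait_le_ht[OF s a(1)])
  show "stage s (y - sink (stage s y) u y) = stage s y" "y - sink (stage s y) u y < ht s"
    using stage_within[OF s a(1) sink_range[OF u _ a(2)]] sink_range(2)[OF u _ a(2)] sink_below[of y a u] le y
    unfolding a_def[symmetric] by (cases "a \<le> y"; simp add: a_def)+
qed

lemma squeeze_chart:
  assumes s: "s \<in> T" and v: "v \<in> strip s" and u: "u \<in> {0..1}"
  shows "squeeze (u, chart s v) = chart s (descent s (u, v))" "descent s (u, v) \<in> strip s"
proof -
  have ns: "node s" using T_node s by simp
  define y a where "y = snd v" "a = stage s y"
  have y: "y < ht s" using v by (simp add: strip_def y_a_def)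
  have a: "a \<in> s" "y < a + wait a" using stage[OF ns y] by (auto simp: y_a_def)
  note st = stage_sink[OF ns y u, folded y_a_def]
  have d: "descent s (u, v) = (ray a u y * fst v, y - sink a u y)"
    by (simp add: descent_def Let_def y_a_def)
  show "descent s (u, v) \<in> strip s" using st(2) by (simp add: d strip_def)
  have "ray a u y * (fst v + succ_in s a * bump a y) = ray a u y * fst v + succ_in s a * bump a (y - sink a u y)"
    using bump_sink[OF u a(2)] by (simp add: algebra_simps)
  then show "squeeze (u, chart s v) = chart s (descent s (u, v))"
    unfolding squeeze_def point_map_chart[OF s v] d
    by (simp add: chart_def st(1) twist_def Sup_Int_atMost[OF a(1)] flip: y_a_def)
qed

lemma continuous_on_descent:
  assumes "s \<in> T"
  shows "continuous_on ({0..1} \<times> strip s) (descent s)"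
proof -
  have ns: "node s" using T_node assms by simp
  let ?y = "\<lambda>x :: real \<times> real \<times> real. (fst x, snd (snd x))"
  have proj: "continuous_on ({0..1} \<times> strip s) ?y" "?y ` ({0..1} \<times> strip s) \<subseteq> {0..1} \<times> {..<ht s}"
    by (auto intro!: continuous_intros simp: strip_def)
  have "continuous_on ({0..1::real} \<times> {..<ht s}) (\<lambda>x. pinch (stage s (snd x)) (snd x))"
  proof (rule continuous_on_stagewise[OF ns, where f="\<lambda>a u y. pinch a y" and g=pinch])
    show "continuous_on ({0..1::real} \<times> {a<..<a + wait a}) (\<lambda>x. pinch a (snd x))" for a
      by (rule continuous_on_compose2[of UNIV "pinch a"])
        (auto intro!: continuous_intros simp: continuous_on_eq_continuous_at isCont_pinch)
  qed (auto simp: pinch_nonneg pinch_le_wait isCont_pinch pinch_eq_0)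
  from continuous_on_compose2[OF this proj]
  have pinch: "continuous_on ({0..1::real} \<times> strip s) (\<lambda>x. pinch (stage s (snd (snd x))) (snd (snd x)))" by simp
  have "continuous_on ({0..1} \<times> {..<ht s}) (\<lambda>x. sink (stage s (snd x)) (fst x) (snd x))"
  proof (rule continuous_on_stagewise[OF ns, where f=sink and g=sink_bound])
    fix a
    have ph: "continuous_on ({0..1} \<times> {a<..<a + wait a}) (\<lambda>x :: real \<times> real. phase a (snd x))"
      by (rule continuous_on_compose2[of UNIV "phase a"])
        (auto intro!: continuous_intros simp: continuous_on_eq_continuous_at isCont_phase)
    then have "continuous_on ({0..1} \<times> {a<..<a + wait a}) (\<lambda>x. ray a (fst x) (snd x))"
      unfolding ray_def pinch_def by (intro continuous_intros)
    then show "continuous_on ({0..1} \<times> {a<..<a + wait a}) (\<lambda>x. sink a (fst x) (snd x))"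
      unfolding sink_def using ph sink_denominator_pos
      by (intro continuous_intros) (auto simp: less_imp_neq[symmetric])
  qed (use sink_le_bound sink_bound_le_wait isCont_sink_bound sink_bound_eq_0 in auto)
  from continuous_on_compose2[OF this proj]
  have sink: "continuous_on ({0..1} \<times> strip s) (\<lambda>x. sink (stage s (snd (snd x))) (fst x) (snd (snd x)))" by simp
  show ?thesis
    unfolding descent_def Let_def ray_def using pinch sink by (intro continuous_intros)
qed

lemma continuous_map_squeeze:
  "continuous_map (prod_topology (top_of_set {0..1::real}) surf) surf squeeze"
proof -
  have "continuous_map (prod_topology (top_of_set {0..1::real}) (subtopology surf UNIV)) surf squeeze"
    using continuous_on_descent squeeze_chart by (intro continuous_map_by_charts[where G=descent]) auto
  then show ?thesis by simp
qed

lemma squeeze_0: "p \<in> topspace surf \<Longrightarrow> squeeze (0, p) = p"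
proof -
  assume "p \<in> topspace surf"
  then obtain s v where s: "s \<in> T" "v \<in> strip s" "p = chart s v" unfolding topspace_surf carrier_set_def by blast
  have "descent s (0, v) = v" by (simp add: descent_def Let_def ray_def sink_def prod_eq_iff)
  then show ?thesis using squeeze_chart(1)[OF s(1,2), of 0] s(3) by simp
qed

text \<open>
  The end of the first homotopy lies in the set of points whose fibre coordinate vanishes together with the bump.
  The condition does not depend on the chart, since the twist vanishes with the bump.
\<close>

definition squeezed :: "'p set" where
  "squeezed = {p. \<forall>s\<in>T. \<forall>v\<in>strip s. p = chart s v \<longrightarrow> bump (stage s (snd v)) (snd v) = 0 \<longrightarrow> fst v = 0}"

lemma squeeze_1: "p \<in> topspace surf \<Longrightarrow> squeeze (1, p) \<in> squeezed"
proof -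
  assume "p \<in> topspace surf"
  then obtain s v where s: "s \<in> T" "v \<in> strip s" "p = chart s v" unfolding topspace_surf carrier_set_def by blast
  have ns: "node s" using T_node s by simp
  define y a where "y = snd v" "a = stage s y"
  have y: "y < ht s" using s by (simp add: strip_def y_a_def)
  have a: "a \<in> s" "y < a + wait a" using stage[OF ns y] by (auto simp: y_a_def)
  note st = stage_sink[OF ns y, of 1, folded y_a_def]
  have d: "descent s (1, v) = (pinch a y * fst v, y - sink a 1 y)"
    by (simp add: descent_def Let_def y_a_def ray_def)
  have sq: "squeeze (1, p) = chart s (descent s (1, v))" "descent s (1, v) \<in> strip s"
    using squeeze_chart[OF s(1,2), of 1] s(3) by auto
  have own: "bump a (y - sink a 1 y) = pinch a y * bump a y" using bump_sink[of 1 y a] a by (simp add: ray_def)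
  have z: "pinch a y * fst v = 0" if "bump a (y - sink a 1 y) = 0"
  proof (cases "a < y")
    case True
    then show ?thesis using pinch_pos[OF True a(2)] bump_pos[OF True a(2)] own that by simp
  qed (simp add: pinch_eq_0)
  show ?thesis unfolding squeezed_def
  proof (intro CollectI ballI impI)
    fix t w assume t: "t \<in> T" "w \<in> strip t" "squeeze (1, p) = chart t w" and b: "bump (stage t (snd w)) (snd w) = 0"
    have eq: "snd w = y - sink a 1 y" "stage t (snd w) = a" "fst w + twist t (snd w) = pinch a y * fst v + twist s (y - sink a 1 y)"
      using chart_eqD[OF s(1) t(1) sq(2) t(2)] sq(1) t(3) st(1) unfolding d by auto
    have b0: "bump a (y - sink a 1 y) = 0" using b eq by simp
    then show "fst w = 0" using eq z st(1) b by (simp add: twist_def)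
  qed
qed

text \<open>
  The second homotopy, in charts: the height is scaled to \<open>0\<close>, and the fibre coordinate changes by the same factor
  as the bump of the stage in which the point started. Where that bump vanishes, division by zero yields
  fibre coordinate zero, in agreement with the definition of \<open>squeezed\<close>.
\<close>

definition slide :: "real set \<Rightarrow> real \<times> real \<times> real \<Rightarrow> real \<times> real" where
  "slide s x = (let y = snd (snd x); y' = (1 - fst x) * y; a = stage s y
     in (fst (snd x) * bump a y' / bump a y, y'))"

definition collapse :: "real \<times> 'p \<Rightarrow> 'p" where
  "collapse = point_map (\<lambda>u C y \<rho>. chart C (\<rho> * bump (Sup C) ((1 - u) * y) / bump (Sup C) y, (1 - u) * y))"

lemma collapse_chart:
  assumes s: "s \<in> T" and v: "v \<in> strip s" and u: "u \<in> {0..1}"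
  shows "collapse (u, chart s v) = chart s (slide s (u, v))" "slide s (u, v) \<in> strip s"
proof -
  have ns: "node s" using T_node s by simp
  define y a where "y = snd v" "a = stage s y"
  have y: "y < ht s" using v by (simp add: strip_def y_a_def)
  have a: "a \<in> s" "y < a + wait a" using stage[OF ns y] by (auto simp: y_a_def)
  have le: "a + wait a \<le> ht s" by (rule wait_le_ht[OF ns a(1)])
  define y' where "y' = (1 - u) * y"
  note b = bump_le_own_stage[OF ns y u, folded y_a_def, folded y'_def]
  have d: "slide s (u, v) = (fst v * bump a y' / bump a y, y')"
    by (simp add: slide_def Let_def y_a_def y'_def)
  show "slide s (u, v) \<in> strip s" using b(1) le by (simp add: d strip_def)
  have "(fst v + succ_in s a * bump a y) * bump a y' / bump a y = fst v * bump a y' / bump a y + succ_in s a * bump a y'"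
    using b(3) by (auto simp: field_simps)
  then show "collapse (u, chart s v) = chart s (slide s (u, v))"
    unfolding collapse_def point_map_chart[OF s v] d chart_segment[OF s a(1) b(1)]
    by (simp add: twist_def Sup_Int_atMost[OF a(1)] flip: y_a_def y'_def)
qed

text \<open>
  Where the bump is positive, the stage is locally constant and the formula is continuous. Elsewhere the fibre
  coordinate is zero at the point itself, and the homotopy does not increase fibre coordinates.
\<close>

lemma continuous_on_slide:
  assumes "s \<in> T"
  shows "continuous_on ({0..1} \<times> {v \<in> strip s. bump (stage s (snd v)) (snd v) = 0 \<longrightarrow> fst v = 0}) (slide s)"
    (is "continuous_on ?Q _")
proof -
  have ns: "node s" using T_node assms by simp
  let ?f = "\<lambda>x. fst (snd x) * bump (stage s (snd (snd x))) ((1 - fst x) * snd (snd x)) / bump (stage s (snd (snd x))) (snd (snd x))"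
  have "continuous_on ?Q ?f"
    unfolding continuous_on_def
  proof
    fix x0 assume x0: "x0 \<in> ?Q"
    define y0 a where "y0 = snd (snd x0)" "a = stage s y0"
    have y0: "y0 < ht s" using x0 by (auto simp: strip_def y0_a_def)
    have a: "a \<in> s" "y0 < a + wait a" using stage[OF ns y0] by (auto simp: y0_a_def)
    have a0: "0 \<le> a" using a ns by (auto simp: node_def)
    show "(?f \<longlongrightarrow> ?f x0) (at x0 within ?Q)"
    proof (cases "a < y0")
      case True
      let ?U = "UNIV \<times> (UNIV \<times> {a<..<a + wait a})"
      let ?V = "{0..1} \<times> (UNIV \<times> {a<..<a + wait a})"
      let ?h = "\<lambda>x. fst (snd x) * bump a ((1 - fst x) * snd (snd x)) / bump a (snd (snd x))"
      have below: "(1 - u) * y < a + wait a" if "u \<in> {0..1}" "y \<in> {a<..<a + wait a}" for u y :: real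
      proof -
        have "(1 - u) * y \<le> y" using that a0 by (intro mult_left_le_one_le) auto
        then show ?thesis using that by simp
      qed
      have "continuous_on ?V ?h"
        using below bump_pos[of a] by (intro continuous_intros continuous_on_compose2[OF continuous_on_bump[of a]]) fastforce+
      then have "continuous_on ?V ?f"
        by (rule continuous_on_eq) (use stage_within[OF ns a(1)] in auto)
      moreover have "x0 \<in> ?V" using x0 True a by (auto simp: mem_Times_iff y0_a_def)
      ultimately have "(?f \<longlongrightarrow> ?f x0) (at x0 within ?V)" unfolding continuous_on_def by blast
      then have "(?f \<longlongrightarrow> ?f x0) (at x0 within ?Q \<inter> ?U)"
        by (rule tendsto_within_subset) auto
      moreover have "at x0 within ?Q = at x0 within ?Q \<inter> ?U"
      proof (rule at_within_nhd[where S="?U"])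
        show "x0 \<in> ?U" using True a by (auto simp: mem_Times_iff y0_a_def)
        show "open ?U" by (intro open_Times) auto
      qed auto
      ultimately show ?thesis by simp
    next
      case False
      then have "bump a y0 = 0" using bump_eq_0 by simp
      then have r0: "fst (snd x0) = 0" using x0 by (auto simp: y0_a_def)
      have "((\<lambda>x. \<bar>fst (snd x)\<bar>) \<longlongrightarrow> \<bar>fst (snd x0)\<bar>) (at x0 within ?Q)" by (intro tendsto_intros)
      then have lim: "((\<lambda>x. \<bar>fst (snd x)\<bar>) \<longlongrightarrow> 0) (at x0 within ?Q)" using r0 by simp
      have "(?f \<longlongrightarrow> 0) (at x0 within ?Q)"
      proof (rule Lim_null_comparison[OF _ lim])
        have "norm (?f x) \<le> \<bar>fst (snd x)\<bar>" if x: "x \<in> ?Q" for x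
        proof -
          define y u where "y = snd (snd x)" "u = fst x"
          have "bump (stage s y) ((1 - u) * y) \<le> bump (stage s y) y"
            using bump_le_own_stage(2)[OF ns, of y u] x by (auto simp: y_u_def strip_def)
          then have "bump (stage s y) ((1 - u) * y) / bump (stage s y) y \<le> 1"
            using bump_nonneg[of "stage s y" y] by (cases "bump (stage s y) y = 0") (auto simp: divide_le_eq_1)
          moreover have "0 \<le> bump (stage s y) ((1 - u) * y) / bump (stage s y) y"
            using bump_nonneg by simp
          ultimately have "\<bar>fst (snd x)\<bar> * (bump (stage s y) ((1 - u) * y) / bump (stage s y) y) \<le> \<bar>fst (snd x)\<bar>"
            by (intro mult_right_le_one_le) auto
          then show ?thesis unfolding y_u_def using bump_nonneg by (simp add: abs_mult abs_divide)
        qed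
        then show "\<forall>\<^sub>F x in at x0 within ?Q. norm (?f x) \<le> \<bar>fst (snd x)\<bar>"
          unfolding eventually_at_filter by (simp add: always_eventually)
      qed
      then show ?thesis using r0 by simp
    qed
  qed
  then show ?thesis unfolding slide_def Let_def by (rule continuous_on_Pair) (intro continuous_intros)
qed

lemma continuous_map_collapse:
  "continuous_map (prod_topology (top_of_set {0..1::real}) (subtopology surf squeezed)) surf collapse"
proof (rule continuous_map_by_charts[where G=slide])
  show "continuous_on ({0..1} \<times> {v \<in> strip s. chart s v \<in> squeezed}) (slide s)" if "s \<in> T" for s
    using continuous_on_slide[OF that] by (rule continuous_on_subset) (use that in \<open>auto simp: squeezed_def\<close>)
qed (use collapse_chart in auto)

lemma collapse_0:
  assumes "p \<in> topspace surf" "p \<in> squeezed"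
  shows "collapse (0, p) = p"
proof -
  obtain s v where s: "s \<in> T" "v \<in> strip s" "p = chart s v" using assms(1) unfolding topspace_surf carrier_set_def by blast
  have "bump (stage s (snd v)) (snd v) = 0 \<longrightarrow> fst v = 0" using assms(2) s by (auto simp: squeezed_def)
  then have "slide s (0, v) = v" by (auto simp: slide_def Let_def prod_eq_iff)
  then show ?thesis using collapse_chart(1)[OF s(1,2), of 0] s(3) by simp
qed

lemma collapse_1:
  assumes "p \<in> topspace surf"
  shows "collapse (1, p) = pt {0} 0 0"
proof -
  obtain s v where s: "s \<in> T" "v \<in> strip s" "p = chart s v" using assms(1) unfolding topspace_surf carrier_set_def by blast
  have ns: "node s" using T_node s by simp
  then have n: "0 \<in> s" "s \<subseteq> {0..}" by (auto simp: node_def)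
  have "0 \<le> stage s (snd v)" using stage(1)[OF ns, of "snd v"] s n by (auto simp: strip_def)
  then have "slide s (1, v) = (0, 0)" using bump_eq_0[of 0 "stage s (snd v)"] by (simp add: slide_def Let_def)
  moreover have "stage s 0 = 0" using stage_within[OF ns n(1), of 0] wait_pos[of 0] by simp
  moreover have "s \<inter> {..0} = {0}" using n by auto
  ultimately show ?thesis using collapse_chart(1)[OF s(1,2), of 1] s(3)
    by (simp add: chart_def twist_def bump_eq_0)
qed

theorem contractible_surf: "contractible_space surf"
proof -
  let ?I = "top_of_set {0..1::real}"
  have sq: "continuous_map surf surf (\<lambda>p. squeeze (1, p))"
    using continuous_map_o_Pair[OF continuous_map_squeeze, of 1] by (simp add: o_def)
  have "homotopic_with (\<lambda>_. True) surf surf id (\<lambda>p. squeeze (1, p))"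
    using continuous_map_squeeze squeeze_0 by (subst homotopic_with) auto
  moreover have "homotopic_with (\<lambda>_. True) surf surf (\<lambda>p. squeeze (1, p)) (\<lambda>_. pt {0} 0 0)"
  proof (subst homotopic_with)
    have top: "squeeze (1, p) \<in> topspace surf" if "p \<in> topspace surf" for p
      using sq that by (auto simp: continuous_map_def)
    have "continuous_map surf (subtopology surf squeezed) (\<lambda>p. squeeze (1, p))"
      using sq squeeze_1 by (auto simp: continuous_map_in_subtopology)
    then have "continuous_map (prod_topology ?I surf) (subtopology surf squeezed) ((\<lambda>p. squeeze (1, p)) \<circ> snd)"
      by (rule continuous_map_compose[OF continuous_map_snd])
    then have "continuous_map (prod_topology ?I surf) (prod_topology ?I (subtopology surf squeezed)) (\<lambda>x. (fst x, squeeze (1, snd x)))"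
      unfolding continuous_map_pairwise by (simp add: o_def continuous_map_fst[unfolded o_def])
    from continuous_map_compose[OF this continuous_map_collapse]
    have "continuous_map (prod_topology ?I surf) surf (\<lambda>x. collapse (fst x, squeeze (1, snd x)))"
      by (simp add: o_def)
    then show "\<exists>h. continuous_map (prod_topology ?I surf) surf h \<and>
        (\<forall>x\<in>topspace surf. h (0, x) = squeeze (1, x)) \<and> (\<forall>x\<in>topspace surf. h (1, x) = pt {0} 0 0) \<and>
        (\<forall>t\<in>{0..1}. True)"
      using collapse_0 collapse_1 top squeeze_1
      by (intro exI[of _ "\<lambda>x. collapse (fst x, squeeze (1, snd x))"]) auto
  qed simp
  ultimately show ?thesis unfolding contractible_space_def using homotopic_with_trans by blast
qed

end

section \<open>Type I and nonmetrizability\<close>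

text \<open>
  The points of the surface are triples of a set of rationals and two real numbers. They can be named by
  real numbers, since each component is coded by a set of naturals.
\<close>

lemma injection_of_rational_nodes:
  obtains pt :: "real set \<Rightarrow> real \<Rightarrow> real \<Rightarrow> real" where
    "\<And>s t y y' r r'. s \<subseteq> \<rat> \<Longrightarrow> t \<subseteq> \<rat> \<Longrightarrow> pt s y r = pt t y' r' \<Longrightarrow> s = t \<and> y = y' \<and> r = r'"
proof -
  have "(UNIV :: real set) \<lesssim> (UNIV :: nat set set)"
    using nat_sets_eqpoll_reals eqpoll_imp_lepoll eqpoll_sym by blast
  then obtain e :: "real \<Rightarrow> nat set" where e: "inj e" unfolding lepoll_def by blast
  have "(UNIV :: nat set set) \<lesssim> (UNIV :: real set)"
    using nat_sets_eqpoll_reals eqpoll_imp_lepoll by blast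
  then obtain d :: "nat set \<Rightarrow> real" where d: "inj d" unfolding lepoll_def by blast
  define join where "join A B C = (\<lambda>n. 3 * n) ` A \<union> (\<lambda>n. 3 * n + 1) ` B \<union> (\<lambda>n. 3 * n + 2) ` C" for A B C :: "nat set"
  have j: "n \<in> A \<longleftrightarrow> 3 * n \<in> join A B C" "n \<in> B \<longleftrightarrow> 3 * n + 1 \<in> join A B C" "n \<in> C \<longleftrightarrow> 3 * n + 2 \<in> join A B C"
    for n A B C unfolding join_def by (auto simp: image_iff; presburger)+
  have join: "A = A' \<and> B = B' \<and> C = C'" if "join A B C = join A' B' C'" for A B C A' B' C'
    using j(1)[of _ A B C] j(1)[of _ A' B' C'] j(2)[of _ B A C] j(2)[of _ B' A' C']
      j(3)[of _ C A B] j(3)[of _ C' A' B'] unfolding that by blast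
  define pt where "pt s y r = d (join (to_nat_on \<rat> ` s) (e y) (e r))" for s :: "real set" and y r
  have inj: "s = t \<and> y = y' \<and> r = r'" if h: "s \<subseteq> \<rat>" "t \<subseteq> \<rat>" "pt s y r = pt t y' r'" for s t y y' r r'
  proof -
    have "join (to_nat_on \<rat> ` s) (e y) (e r) = join (to_nat_on \<rat> ` t) (e y') (e r')"
      using h(3) d unfolding pt_def by (simp add: inj_eq)
    from join[OF this] have eq: "to_nat_on \<rat> ` s = to_nat_on \<rat> ` t" "e y = e y'" "e r = e r'" by simp_all
    have "s = t" using inj_on_image_eq_iff[OF inj_on_to_nat_on[OF countable_rat] h(1,2)] eq(1) by simp
    then show ?thesis using eq e by (simp add: inj_eq)
  qed
  show thesis by (rule that[of pt], rule inj)
qed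

context branching_surface
begin

lemma surf_pointE:
  assumes "p \<in> topspace surf"
  obtains s v where "s \<in> T" "v \<in> strip s" "p = chart s v"
  using assms unfolding topspace_surf carrier_set_def by blast

lemma chart_in_chart_segment:
  assumes s: "s \<in> T" and v: "v \<in> strip s" and a: "a \<in> s" "snd v < a + wait a"
  shows "chart s v \<in> chart (s \<inter> {..a}) ` strip (s \<inter> {..a})"
proof -
  have "(fst v + succ_in s a * bump a (snd v), snd v) \<in> strip (s \<inter> {..a})"
    using a by (simp add: strip_def ht_def Sup_Int_atMost)
  then show ?thesis using chart_segment[OF s a, of "fst v"] by (metis image_eqI prod.collapse)
qed

text \<open>
  A common point of two charts above height \<open>a \<in> s\<close> has a stage at or after \<open>a\<close>, so both nodes contain the
  segment up to \<open>a\<close>.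
\<close>

lemma above_node_common_segment:
  assumes s: "s \<in> T" and t: "t \<in> T" and v: "v \<in> strip s" and w: "w \<in> strip t" and eq: "chart s v = chart t w"
    and a: "a \<in> s" "a < snd v"
  shows "a \<in> t \<and> t \<inter> {..a} = s \<inter> {..a}"
proof -
  define y where "y = snd v"
  have ns: "node s" and nt: "node t" using T_node s t by auto
  have y: "y < ht s" using v by (simp add: strip_def y_def)
  have "a \<le> stage s y" using stage_within[OF ns a(1)] stage(2)[OF ns y] below_stage[OF ns stage(1)[OF ns y]] a
    node_gap[OF ns stage(1)[OF ns y] a(1)] unfolding y_def by force
  moreover have seg: "s \<inter> {..stage s y} = t \<inter> {..stage t (snd w)}"
    unfolding y_def using pt_inj[OF segment_in_T[OF s v] segment_in_T[OF t w] eq[unfolded chart_def]] by blast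
  moreover have st: "stage s y = stage t (snd w)" using chart_eqD(2)[OF s t v w eq] by (simp add: y_def)
  ultimately have "s \<inter> {..stage s y} = t \<inter> {..stage s y}" "a \<le> stage s y" by simp_all
  then have "x \<in> s \<longleftrightarrow> x \<in> t" if "x \<le> a" for x using that by (metis IntD1 IntI atMost_iff order_trans)
  then show ?thesis using a(1) by auto
qed

lemma second_countable_chart:
  assumes "s \<in> T"
  shows "second_countable (subtopology surf (chart s ` strip s))"
proof -
  obtain \<B> :: "(real \<times> real) set set" where \<B>: "countable \<B>" "\<And>B. B \<in> \<B> \<Longrightarrow> open B"
      "\<And>U. open U \<Longrightarrow> \<exists>\<U>. \<U> \<subseteq> \<B> \<and> U = \<Union>\<U>"
    using univ_second_countable by blast
  have "\<exists>V\<in>\<B>. x \<in> V \<and> V \<subseteq> U" if "open U" "x \<in> U" for U x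
    using \<B>(3)[OF that(1)] that(2) by blast
  then have "second_countable (euclidean :: (real \<times> real) topology)"
    unfolding second_countable_def using \<B>(1,2) by (intro exI[of _ \<B>]) auto
  then have "second_countable (top_of_set (strip s))"
    by (rule second_countable_subtopology)
  then show ?thesis
    using homeomorphic_space_second_countability[OF homeomorphic_map_imp_homeomorphic_space[OF homeomorphic_map_chart[OF assms]]]
    by simp
qed

end

locale tree_surface = branching_surface "\<Union>\<alpha>. L \<alpha>" pt
  for L :: "countable_ordinal \<Rightarrow> real set set" and pt :: "real set \<Rightarrow> real \<Rightarrow> real \<Rightarrow> 'p" +
  assumes L: "level L \<alpha> (L \<alpha>)"
begin

definition below :: "countable_ordinal \<Rightarrow> 'p set" where
  "below \<alpha> = (\<Union>\<beta>\<in>{..<\<alpha>}. \<Union>s\<in>L \<beta>. chart s ` strip s)"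

lemma L_countable: "countable (L \<alpha>)"
  using L[of \<alpha>] by (simp add: level_def)

lemma below_mono: "\<alpha> \<le> \<beta> \<Longrightarrow> below \<alpha> \<subseteq> below \<beta>"
  unfolding below_def by (intro UN_mono) auto

lemma openin_below: "openin surf (below \<alpha>)"
  unfolding below_def using openin_chart_image[OF _ subset_refl open_strip]
  by (intro openin_Union) auto

lemma Union_below: "(\<Union>\<alpha>. below \<alpha>) = topspace surf"
proof
  show "(\<Union>\<alpha>. below \<alpha>) \<subseteq> topspace surf" using openin_subset[OF openin_below] by blast
  show "topspace surf \<subseteq> (\<Union>\<alpha>. below \<alpha>)"
  proof
    fix p assume "p \<in> topspace surf"
    then obtain s v where "s \<in> (\<Union>\<alpha>. L \<alpha>)" "v \<in> strip s" "p = chart s v" by (rule surf_pointE)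
    then obtain \<beta> where s: "s \<in> L \<beta>" "p \<in> chart s ` strip s" by auto
    obtain \<alpha> where "\<beta> < \<alpha>" using countable_set_strictly_bounded[of "{\<beta>}"] by auto
    then show "p \<in> (\<Union>\<alpha>. below \<alpha>)" using s unfolding below_def by auto
  qed
qed

text \<open>
  Let \<open>p\<close> be a point in the chart of a node \<open>s\<close> on a level above \<open>\<alpha>\<close>, and let \<open>a\<close> be the maximum of
  the segment of \<open>s\<close> on level \<open>\<alpha>\<close>. If \<open>p\<close> is not in the chart of that segment, then the part of the
  chart of \<open>s\<close> above height \<open>a\<close> is a neighbourhood of \<open>p\<close>. It misses \<open>below \<alpha>\<close>, because nodes which share
  a point with it have the segment on level \<open>\<alpha>\<close> as an initial segment.
\<close>

lemma closure_below: "surf closure_of (below \<alpha>) \<subseteq> (\<Union>\<beta>\<in>{..\<alpha>}. \<Union>s\<in>L \<beta>. chart s ` strip s)"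
proof
  fix p assume p: "p \<in> surf closure_of (below \<alpha>)"
  then have "p \<in> topspace surf" using closure_of_subset_topspace by fast
  then obtain s v where sT: "s \<in> (\<Union>\<alpha>. L \<alpha>)" and "v \<in> strip s" "p = chart s v" by (rule surf_pointE)
  then obtain \<gamma> where s: "s \<in> L \<gamma>" "v \<in> strip s" "p = chart s v" by auto
  have ns: "node s" using T_node[OF sT] .
  show "p \<in> (\<Union>\<beta>\<in>{..\<alpha>}. \<Union>s\<in>L \<beta>. chart s ` strip s)"
  proof (cases "\<gamma> \<le> \<alpha>")
    case True
    then show ?thesis using s by blast
  next
    case False
    then obtain a where a: "a \<in> s" "a < Sup s" "s \<inter> {..a} \<in> L \<alpha>"
      using level_fits[OF L s(1)] unfolding fits_def by (meson not_le)
    show ?thesis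
    proof (cases "snd v < a + wait a")
      case True
      then show ?thesis using chart_in_chart_segment[OF sT s(2) a(1)] a(3) s(3) by blast
    next
      case above: False
      define V where "V = {w. w \<in> strip s \<and> a < snd w}"
      have "openin surf (chart s ` V)"
      proof (rule openin_chart_image[OF sT])
        have "V = strip s \<inter> {w. a < snd w}" unfolding V_def by blast
        moreover have "open {w :: real \<times> real. a < snd w}" by (intro open_Collect_less continuous_intros)
        ultimately show "open V" using open_strip[of s] by (simp add: open_Int)
      qed (auto simp: V_def)
      moreover have "v \<in> V" using s(2) above wait_pos[of a] by (simp add: V_def)
      then have "p \<in> chart s ` V" using s(3) by simp
      ultimately have "\<exists>q\<in>below \<alpha>. q \<in> chart s ` V"
        using p unfolding in_closure_of by (elim conjE allE[of _ "chart s ` V"]) (simp add: Bex_def)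
      then obtain q where q: "q \<in> below \<alpha>" "q \<in> chart s ` V" ..
      obtain v' where v': "q = chart s v'" "v' \<in> strip s" "a < snd v'"
        using q(2) unfolding V_def by auto
      obtain \<beta> t w where t: "\<beta> < \<alpha>" "t \<in> L \<beta>" "w \<in> strip t" "q = chart t w"
        using q(1) unfolding below_def by auto
      have "chart s v' = chart t w" using v' t by simp
      from above_node_common_segment[OF sT _ v'(2) t(3) this a(1) v'(3)] t(2)
      have at: "a \<in> t" "t \<inter> {..a} = s \<inter> {..a}" by blast+
      have nt: "node t" using T_node t(2) by blast
      show ?thesis
      proof (cases "a = Sup t")
        case True
        then have "t \<in> L \<alpha>" using at(2) a(3) Int_Sup_eq[OF nt] by simp
        then show ?thesis using level_unique[OF L t(2)] t(1) by blast
      next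
        case False
        then have "a < Sup t" using node_le_Sup[OF nt at(1)] by simp
        then have "\<alpha> < \<beta>" using level_of_segment[OF L t(2) at(1)] at(2) a(3) by simp
        then show ?thesis using t(1) by simp
      qed
    qed
  qed
qed

lemma Lindelof_closure_below: "Lindelof_space (subtopology surf (surf closure_of (below \<alpha>)))"
proof -
  let ?U = "(\<lambda>s. chart s ` strip s) ` (\<Union>\<beta>\<in>{..\<alpha>}. L \<beta>)"
  let ?W = "\<Union>?U"
  have "countable ?U"
    by (intro countable_image countable_UN countable_atMost_countable_ordinal L_countable)
  then have "Lindelof_space (subtopology surf ?W)"
    using second_countable_chart second_countable_imp_Lindelof_space
    by (intro Lindelof_space_Union) auto
  moreover have sub: "surf closure_of (below \<alpha>) \<subseteq> ?W" using closure_below[of \<alpha>] by blast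
  have "closedin (subtopology surf ?W) (surf closure_of (below \<alpha>))"
    using sub closedin_subset_topspace[OF closedin_closure_of] by blast
  ultimately have "Lindelof_space (subtopology (subtopology surf ?W) (surf closure_of (below \<alpha>)))"
    using Lindelof_space_closedin_subtopology by blast
  then show ?thesis using sub by (simp add: subtopology_subtopology Int_absorb1)
qed

lemma closure_below_less: "\<alpha> < \<beta> \<Longrightarrow> surf closure_of (below \<alpha>) \<subseteq> below \<beta>"
  using closure_below[of \<alpha>] unfolding below_def by (force dest: le_less_trans)

lemma type_I_surf: "type_I surf"
  unfolding type_I_def
proof (intro exI conjI ballI)
  let ?A = "\<lambda>x. below (Abs_countable_ordinal x)"
  show "topspace surf = (\<Union>x\<in>Field omega1. ?A x)"
  proof -
    have "(\<Union>x\<in>Field omega1. ?A x) = (\<Union>\<alpha>. below \<alpha>)"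
      using type_definition.Abs_image[OF type_definition_countable_ordinal] by (metis image_image)
    then show ?thesis using Union_below by simp
  qed
  fix x assume "x \<in> Field omega1"
  show "openin surf (?A x)" by (rule openin_below)
  show "Lindelof_space (subtopology surf (surf closure_of (?A x)))" by (rule Lindelof_closure_below)
next
  fix y x assume y: "y \<in> Field omega1" and x: "x \<in> underS omega1 y"
  then have "x \<in> Field omega1" by (auto simp: underS_def Field_def)
  then have "Abs_countable_ordinal x < Abs_countable_ordinal y"
    using x y by (simp add: less_countable_ordinal_def Abs_countable_ordinal_inverse)
  then show "surf closure_of (below (Abs_countable_ordinal x)) \<subseteq> below (Abs_countable_ordinal y)"
    by (rule closure_below_less)
qed

lemma below_proper: "below \<alpha> \<noteq> topspace surf"
proof
  assume eq: "below \<alpha> = topspace surf"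
  obtain s where s: "s \<in> L \<alpha>" using level_nonempty[OF L, of \<alpha>] by blast
  then have sT: "s \<in> (\<Union>\<alpha>. L \<alpha>)" by blast
  have ns: "node s" using T_node[OF sT] .
  define y where "y = Sup s + wait (Sup s) / 2"
  have v: "(0, y) \<in> strip s" "Sup s < y" using wait_pos[of "Sup s"] by (auto simp: strip_def ht_def y_def)
  then have "chart s (0, y) \<in> below \<alpha>" using chart_in[OF sT] eq by blast
  then obtain \<beta> t w where t: "\<beta> < \<alpha>" "t \<in> L \<beta>" "w \<in> strip t" "chart s (0, y) = chart t w"
    unfolding below_def by blast
  have nt: "node t" using T_node t(2) by blast
  have "Sup s \<in> t \<and> t \<inter> {..Sup s} = s \<inter> {..Sup s}"
    using above_node_common_segment[OF sT _ v(1) t(3,4) node_Sup_in[OF ns]] v(2) t(2) by auto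
  then have at: "Sup s \<in> t" "t \<inter> {..Sup s} = s" using Int_Sup_eq[OF ns] by simp_all
  show False
  proof (cases "Sup s = Sup t")
    case True
    then have "s = t" using at Int_Sup_eq[OF nt] by metis
    then show False using level_unique[OF L s] t by blast
  next
    case False
    then have "Sup s < Sup t" using node_le_Sup[OF nt at(1)] by simp
    then have "\<alpha> < \<beta>" using level_of_segment[OF L t(2) at(1)] at(2) s by simp
    then show False using t(1) by simp
  qed
qed

text \<open>
  A countable dense set would lie in some \<open>below \<alpha>\<close>, as countable sets of countable ordinals are bounded, and
  the closure of \<open>below \<alpha>\<close> is proper.
\<close>

lemma not_metrizable_surf:
  assumes "connected_space surf"
  shows "\<not> metrizable_space surf"
proof
  assume met: "metrizable_space surf"
  have loc: "\<exists>U D. openin surf U \<and> p \<in> U \<and> countable D \<and> D \<subseteq> topspace surf \<and> U \<subseteq> surf closure_of D"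
    if p: "p \<in> topspace surf" for p
  proof -
    obtain s v where s: "s \<in> (\<Union>\<alpha>. L \<alpha>)" "v \<in> strip s" "p = chart s v"
      using p by (rule surf_pointE)
    let ?U = "chart s ` strip s"
    have U: "openin surf ?U" using openin_chart_image[OF s(1) subset_refl open_strip] .
    have "separable_space (subtopology surf ?U)"
      using second_countable_chart[OF s(1)] second_countable_imp_separable_space by blast
    then obtain D where D: "countable D" "D \<subseteq> topspace (subtopology surf ?U)"
      "subtopology surf ?U closure_of D = topspace (subtopology surf ?U)"
      unfolding separable_space_def by blast
    have "?U \<subseteq> surf closure_of D"
      using D(3) closure_of_subtopology_subset[of surf ?U D] openin_subset[OF U] by (simp add: Int_absorb1)
    then show ?thesis using D U s by (intro exI[of _ ?U] exI[of _ D]) auto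
  qed
  obtain D where D: "countable D" "D \<subseteq> topspace surf" "surf closure_of D = topspace surf"
    using connected_locally_separable_metrizable_imp_separable[OF met assms loc] by blast
  have "\<forall>p\<in>D. \<exists>\<alpha>. p \<in> below \<alpha>" using D(2) Union_below by blast
  then obtain f where f: "\<And>p. p \<in> D \<Longrightarrow> p \<in> below (f p)" by metis
  obtain \<alpha> where \<alpha>: "\<forall>x\<in>f ` D. x < \<alpha>"
    by (rule countable_set_strictly_bounded[OF countable_image[OF D(1)]])
  have "D \<subseteq> below \<alpha>"
  proof
    fix p assume p: "p \<in> D"
    then have "f p < \<alpha>" using \<alpha> by blast
    then have "below (f p) \<subseteq> below \<alpha>" by (intro below_mono less_imp_le)
    then show "p \<in> below \<alpha>" using f[OF p] by (rule subsetD)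
  qed
  then have "topspace surf \<subseteq> surf closure_of (below \<alpha>)" using closure_of_mono[of D _ surf] D(3) by simp
  moreover obtain \<beta> where "\<alpha> < \<beta>" using countable_set_strictly_bounded[of "{\<alpha>}"] by auto
  ultimately have "topspace surf \<subseteq> below \<beta>" using closure_below_less by blast
  then show False using below_proper[of \<beta>] openin_subset[OF openin_below] by blast
qed

end

section \<open>The surface\<close>

theorem theorem1p2:
  shows "\<exists>X :: real topology.
           surface X \<and> type_I X \<and> contractible_space X \<and> \<not> metrizable_space X"
proof -
  obtain L where L: "\<And>\<alpha>. level L \<alpha> (L \<alpha>)" using tree_levels_exist by blast
  obtain pt :: "real set \<Rightarrow> real \<Rightarrow> real \<Rightarrow> real" where
    pt: "\<And>s t y y' r r'. s \<subseteq> \<rat> \<Longrightarrow> t \<subseteq> \<rat> \<Longrightarrow> pt s y r = pt t y' r' \<Longrightarrow> s = t \<and> y = y' \<and> r = r'"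
    using injection_of_rational_nodes by blast
  have node: "node s" if "s \<in> L \<alpha>" for s \<alpha>
    using level_fits[OF L that] by (simp add: fits_def)
  interpret tree_surface L pt
  proof (unfold_locales)
    show "node s" if "s \<in> (\<Union>\<alpha>. L \<alpha>)" for s using that node by blast
    show "s \<inter> {..a} \<in> (\<Union>\<alpha>. L \<alpha>)" if h: "s \<in> (\<Union>\<alpha>. L \<alpha>)" "a \<in> s" for s a
    proof -
      obtain \<alpha> where s: "s \<in> L \<alpha>" using h by blast
      show ?thesis
      proof (cases "a = Sup s")
        case True
        then have "s \<inter> {..a} = s" using Int_Sup_eq[OF node[OF s]] by simp
        then show ?thesis using s by auto
      next
        case False
        then have "a < Sup s" using node_le_Sup[OF node[OF s] h(2)] by simp
        then show ?thesis using level_fits[OF L s] h(2) unfolding fits_def by blast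
      qed
    qed
    show "{0} \<in> (\<Union>\<alpha>. L \<alpha>)" using level_root[OF L] by blast
    show "s = t \<and> y = y' \<and> r = r'"
      if "s \<in> (\<Union>\<alpha>. L \<alpha>)" "t \<in> (\<Union>\<alpha>. L \<alpha>)" "pt s y r = pt t y' r'" for s t y y' r r'
      using pt[OF _ _ that(3)] that(1,2) node by (auto simp: node_def)
  qed (rule L)
  have conn: "connected_space surf"
    using contractible_surf contractible_imp_connected_space by blast
  have "surface surf"
    unfolding manifold_def using conn Hausdorff_surf surf_locally_Euclidean by auto
  then show ?thesis
    using type_I_surf contractible_surf not_metrizable_surf[OF conn] by blast
qed

end
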